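(* Let $N$ and $P$ be $C^1$-manifolds, let $V\subset N$ be a closed subset, let $\Sigma$ be a prestratification of $V$, and let $f:N\to P$ be a stratified map for $\Sigma$. Suppose that $\Sigma$ is $(a_f)$-regular. Then: (i) for every $C^1$-manifold $M$ and every compact set $K\subset M$, the set $T_K=\{g\in C^1(M,N) : g\pitchfork_K \mathfrak{F}^f_\Sigma\}$ is open in $C^1(M,N)$ with the weak topology; (ii) for every $C^1$-manifold $M$ and every closed set $K\subset M$, the set $T_K=\{g\in C^1(M,N) : g\pitchfork_K \mathfrak{F}^f_\Sigma\}$ is open in $C^1(M,N)$ with the strong topology.
   Context: Prestratification: let $V$ be a closed subset of a $C^1$-manifold $N$. A prestratification $\Sigma$ of $V$ is a collection of pairwise disjoint subsets $\{S_\alpha\}_{\alpha\in\Lambda}$ of $V$ (the strata) such that $\bigcup_\alpha S_\alpha=V$, each $S_\alpha$ is an embedded connected ($C^1$) submanifold of $N$, and every point of $V$ has a neighbourhood in $N$ meeting only finitely many strata. (No frontier condition is assumed.) Stratified map: a $C^1$-map $f:N\to P$ such that the restriction $f|_S$ has constant rank on every stratum $S$ of $\Sigma$. Induced foliation: if $f$ has constant rank on a submanifold $S$ of $N$, then $\mathfrak{F}^f_S$ denotes the foliation of $S$ induced by $f$, whose leaves are the connected components of the fibres of $f|_S$; for $x\in S$, $T_x(\mathfrak{F}^f_S)=\ker d_x(f|_S)$ is the tangent space at $x$ of the leaf through $x$. $(a_f)$-regularity: let $X,Y$ be submanifolds of $N$ on each of which $f$ has constant rank. $X$ is $(a_f)$-regular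 over $Y$ at $y\in Y\cap\overline{X}$ if for every sequence $\{x_i\}$ in $X$ converging to $y$ such that $T_{x_i}(\mathfrak{F}^f_X)$ converges (in the Grassmann bundle of $TN$) to some $\tau$, one has $T_y(\mathfrak{F}^f_Y)\subset\tau$. A pair of strata $(X,Y)$ is $(a_f)$-regular if $X$ is $(a_f)$-regular over $Y$ at every point of $Y\cap\overline{X}$ and $Y$ is $(a_f)$-regular over $X$ at every point of $X\cap\overline{Y}$. $\Sigma$ is $(a_f)$-regular if every pair of strata of $\Sigma$ is $(a_f)$-regular. Transversality: for a $C^1$-map $g:M\to N$ and a subset $K\subset M$, $g\pitchfork_K\mathfrak{F}^f_\Sigma$ means that $g$ is transverse at every point of $K$ to every leaf of $\mathfrak{F}^f_S$ for every stratum $S$ of $\Sigma$; that is, for every $w\in K$ and every stratum $S$ with $g(w)\in S$, $Dg_w(T_wM)+T_{g(w)}(\mathfrak{F}^f_S)=T_{g(w)}N$. $C^1(M,N)$ is the set of all $C^1$-maps from $M$ to $N$; the weak topology is the $C^1$ compact-open topology and the strong topology is the $C^1$ Whitney (fine) topology. *)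

theory Defs
  imports "HOL-Analysis.Analysis"
begin

section \<open>\<open>C\<^sup>1\<close>-manifolds and \<open>C\<^sup>1\<close>-maps\<close>

text \<open>
  A manifold is a Hausdorff, second countable type \<open>'m\<close> together with a maximal \<open>C\<^sup>1\<close>-atlas. The
  model space \<open>'e\<close> is a finite-dimensional real normed space rather than a type of class
  \<^class>\<open>euclidean_space\<close>, because the latter class excludes dimension \<open>0\<close>.
  A chart is a pair \<open>(U, \<phi>)\<close>; the values of \<open>\<phi>\<close> outside \<open>U\<close> are irrelevant.
\<close>

type_synonym ('m, 'e) chart = "'m set \<times> ('m \<Rightarrow> 'e)"

abbreviation chart_inv :: "('m, 'e) chart \<Rightarrow> 'e \<Rightarrow> 'm" where
  "chart_inv c \<equiv> inv_into (fst c) (snd c)"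

definition is_chart :: "('m::topological_space, 'e::real_normed_vector) chart \<Rightarrow> bool" where
  "is_chart c \<longleftrightarrow> open (fst c) \<and> open (snd c ` fst c) \<and>
     homeomorphism (fst c) (snd c ` fst c) (snd c) (chart_inv c)"

text \<open>Used for open sets \<open>W\<close> only.\<close>

definition C1_on :: "'e::real_normed_vector set \<Rightarrow> ('e \<Rightarrow> 'f::real_normed_vector) \<Rightarrow> bool" where
  "C1_on W h \<longleftrightarrow> (\<exists>h' :: 'e \<Rightarrow> 'e \<Rightarrow>\<^sub>L 'f.
     (\<forall>x\<in>W. (h has_derivative blinfun_apply (h' x)) (at x)) \<and> continuous_on W h')"

definition C1_compatible ::
    "('m::topological_space, 'e::real_normed_vector) chart \<Rightarrow> ('m, 'e) chart \<Rightarrow> bool" where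
  "C1_compatible c d \<longleftrightarrow>
     C1_on (snd c ` (fst c \<inter> fst d)) (snd d \<circ> chart_inv c) \<and>
     C1_on (snd d ` (fst c \<inter> fst d)) (snd c \<circ> chart_inv d)"

definition C1_manifold ::
    "('m::{t2_space, second_countable_topology}, 'e::real_normed_vector) chart set \<Rightarrow> bool" where
  "C1_manifold A \<longleftrightarrow>
     (\<exists>B :: 'e set. finite B \<and> span B = UNIV) \<and>
     (\<forall>c\<in>A. is_chart c) \<and>
     (\<Union>c\<in>A. fst c) = UNIV \<and>
     (\<forall>c\<in>A. \<forall>d\<in>A. C1_compatible c d) \<and>
     (\<forall>c. is_chart c \<longrightarrow> (\<forall>d\<in>A. C1_compatible c d) \<longrightarrow> c \<in> A)"

definition local_rep ::
    "('m, 'e) chart \<Rightarrow> ('n, 'f) chart \<Rightarrow> ('m \<Rightarrow> 'n) \<Rightarrow> 'e \<Rightarrow> 'f" where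
  "local_rep c d g = snd d \<circ> g \<circ> chart_inv c"

definition C1_maps ::
    "('m::topological_space, 'e::real_normed_vector) chart set \<Rightarrow>
     ('n::topological_space, 'f::real_normed_vector) chart set \<Rightarrow> ('m \<Rightarrow> 'n) set" where
  "C1_maps A B = {g. continuous_on UNIV g \<and>
     (\<forall>c\<in>A. \<forall>d\<in>B. C1_on (snd c ` (fst c \<inter> g -` fst d)) (local_rep c d g))}"


section \<open>Tangent spaces and differentials\<close>

definition charts_at :: "('m, 'e) chart set \<Rightarrow> 'm \<Rightarrow> ('m, 'e) chart set" where
  "charts_at A p = {c \<in> A. p \<in> fst c}"

text \<open>
  A tangent vector at \<open>p\<close> is the family of its coordinate vectors in all charts around \<open>p\<close>, related
  by the derivatives of the transition maps (and \<open>0\<close> on all other pairs). Evaluation at a chart around \<open>p\<close>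
  identifies \<open>tangent_space A p\<close> with the model space.
\<close>

type_synonym ('m, 'e) tvec = "('m, 'e) chart \<Rightarrow> 'e"

definition tangent_space ::
    "('m, 'e::real_normed_vector) chart set \<Rightarrow> 'm \<Rightarrow> ('m, 'e) tvec set" where
  "tangent_space A p = {v.
     (\<forall>c\<in>charts_at A p. \<forall>d\<in>charts_at A p.
        v d = frechet_derivative (snd d \<circ> chart_inv c) (at (snd c p)) (v c)) \<and>
     (\<forall>c. c \<notin> charts_at A p \<longrightarrow> v c = 0)}"

text \<open>By the chain rule the result does not depend on the chart chosen at \<open>p\<close>.\<close>

definition differential ::
    "('m, 'e::real_normed_vector) chart set \<Rightarrow> ('n, 'f::real_normed_vector) chart set \<Rightarrow>
     ('m \<Rightarrow> 'n) \<Rightarrow> 'm \<Rightarrow> ('m, 'e) tvec \<Rightarrow> ('n, 'f) tvec" where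
  "differential A B g p v = (\<lambda>d.
     if d \<in> charts_at B (g p)
     then let c = (SOME c. c \<in> charts_at A p)
          in frechet_derivative (local_rep c d g) (at (snd c p)) (v c)
     else 0)"

definition coord :: "('m, 'e) chart \<Rightarrow> ('m, 'e) tvec set \<Rightarrow> 'e set" where
  "coord c L = (\<lambda>v. v c) ` L"


section \<open>Submanifolds\<close>

definition slice_chart ::
    "('m, 'e::real_normed_vector) chart set \<Rightarrow> 'm set \<Rightarrow> 'm \<Rightarrow> ('m, 'e) chart \<Rightarrow> 'e set \<Rightarrow> bool" where
  "slice_chart A S p c E \<longleftrightarrow> c \<in> charts_at A p \<and> subspace E \<and>
     snd c ` (S \<inter> fst c) = E \<inter> snd c ` fst c"

definition embedded_submanifold ::
    "('m, 'e::real_normed_vector) chart set \<Rightarrow> 'm set \<Rightarrow> bool" where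
  "embedded_submanifold A S \<longleftrightarrow>
     (\<exists>k. \<forall>p\<in>S. \<exists>c E. slice_chart A S p c E \<and> dim E = k)"

text \<open>\<open>T\<^sub>p S\<close> as a subspace of \<open>T\<^sub>p M\<close>: in a slice chart it is the slice \<open>E\<close>.\<close>

definition sub_tangent_space ::
    "('m, 'e::real_normed_vector) chart set \<Rightarrow> 'm set \<Rightarrow> 'm \<Rightarrow> ('m, 'e) tvec set" where
  "sub_tangent_space A S p =
     {v \<in> tangent_space A p. \<exists>c E. slice_chart A S p c E \<and> v c \<in> E}"


section \<open>Stratifications and the induced foliations\<close>

definition prestratification ::
    "('n::topological_space, 'e::real_normed_vector) chart set \<Rightarrow> 'n set \<Rightarrow> 'n set set \<Rightarrow> bool" where
  "prestratification A V \<Sigma> \<longleftrightarrow>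
     pairwise disjnt \<Sigma> \<and> \<Union>\<Sigma> = V \<and>
     (\<forall>S\<in>\<Sigma>. embedded_submanifold A S \<and> connected S) \<and>
     (\<forall>p\<in>V. \<exists>W. open W \<and> p \<in> W \<and> finite {S\<in>\<Sigma>. S \<inter> W \<noteq> {}})"

definition constant_rank_on ::
    "('n, 'e::real_normed_vector) chart set \<Rightarrow> ('p, 'f::real_normed_vector) chart set \<Rightarrow>
     ('n \<Rightarrow> 'p) \<Rightarrow> 'n set \<Rightarrow> bool" where
  "constant_rank_on A B f S \<longleftrightarrow>
     (\<exists>r. \<forall>x\<in>S. \<forall>d\<in>charts_at B (f x).
        dim (coord d (differential A B f x ` sub_tangent_space A S x)) = r)"

definition stratified_map ::
    "('n::topological_space, 'e::real_normed_vector) chart set \<Rightarrow>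
     ('p::topological_space, 'f::real_normed_vector) chart set \<Rightarrow>
     'n set set \<Rightarrow> ('n \<Rightarrow> 'p) \<Rightarrow> bool" where
  "stratified_map A B \<Sigma> f \<longleftrightarrow> f \<in> C1_maps A B \<and> (\<forall>S\<in>\<Sigma>. constant_rank_on A B f S)"

text \<open>
  The tangent space at \<open>x \<in> S\<close> of the leaf through \<open>x\<close> of the foliation of \<open>S\<close> by the connected
  components of the fibres of \<open>f|\<^sub>S\<close>, i.e. the kernel of \<open>d\<^sub>x(f|\<^sub>S)\<close>.
\<close>

definition leaf_tangent ::
    "('n, 'e::real_normed_vector) chart set \<Rightarrow> ('p, 'f::real_normed_vector) chart set \<Rightarrow>
     ('n \<Rightarrow> 'p) \<Rightarrow> 'n set \<Rightarrow> 'n \<Rightarrow> ('n, 'e) tvec set" where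
  "leaf_tangent A B f S x =
     {v \<in> sub_tangent_space A S x. differential A B f x v = (\<lambda>d. 0)}"


section \<open>Convergence in the Grassmann bundle\<close>

definition frames :: "nat \<Rightarrow> (nat \<Rightarrow> 'e::real_normed_vector) set" where
  "frames k = {b \<in> {..<k} \<rightarrow>\<^sub>E UNIV. inj_on b {..<k} \<and> independent (b ` {..<k})}"

definition frame_topology :: "nat \<Rightarrow> (nat \<Rightarrow> 'e::real_normed_vector) topology" where
  "frame_topology k = subtopology (product_topology (\<lambda>_. euclidean) {..<k}) (frames k)"

text \<open>The quotient topology of the space of \<open>k\<close>-frames under the map \<open>b \<mapsto> span b\<close>.\<close>

definition grassmannian :: "nat \<Rightarrow> 'e::real_normed_vector set topology" where
  "grassmannian k = topology (\<lambda>\<U>. \<U> \<subseteq> (\<lambda>b. span (b ` {..<k})) ` frames k \<and>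
     openin (frame_topology k) {b \<in> frames k. span (b ` {..<k}) \<in> \<U>})"

lemma openin_grassmannian:
  "openin (grassmannian k) \<U> \<longleftrightarrow> \<U> \<subseteq> (\<lambda>b. span (b ` {..<k})) ` frames k \<and>
     openin (frame_topology k) {b \<in> frames k. span (b ` {..<k}) \<in> \<U>}"
proof -
  let ?P = "\<lambda>\<U> :: 'a set set. \<U> \<subseteq> (\<lambda>b. span (b ` {..<k})) ` frames k \<and>
     openin (frame_topology k) {b \<in> frames k. span (b ` {..<k}) \<in> \<U>}"
  have "istopology ?P"
    unfolding istopology_def
  proof (intro conjI allI impI)
    fix S T assume "?P S" "?P T"
    moreover have "{b \<in> frames k. span (b ` {..<k}) \<in> S \<inter> T} =
      {b \<in> frames k. span (b ` {..<k}) \<in> S} \<inter> {b \<in> frames k. span (b ` {..<k}) \<in> T}" by auto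
    ultimately show "S \<inter> T \<subseteq> (\<lambda>b. span (b ` {..<k})) ` frames k"
      "openin (frame_topology k) {b \<in> frames k. span (b ` {..<k}) \<in> S \<inter> T}"
      by (auto simp only: openin_Int)
  next
    fix \<K> assume *: "\<forall>K\<in>\<K>. ?P K"
    then show "\<Union>\<K> \<subseteq> (\<lambda>b. span (b ` {..<k})) ` frames k" by (meson Sup_least)
    have "{b \<in> frames k. span (b ` {..<k}) \<in> \<Union>\<K>} =
      (\<Union>K\<in>\<K>. {b \<in> frames k. span (b ` {..<k}) \<in> K})" by auto
    with * show "openin (frame_topology k) {b \<in> frames k. span (b ` {..<k}) \<in> \<Union>\<K>}"
      by (auto simp only: intro!: openin_Union)
  qed
  then show ?thesis
    unfolding grassmannian_def by (simp add: topology_inverse')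
qed

text \<open>
  Convergence of \<open>(x\<^sub>i, L\<^sub>i)\<close> to \<open>(y, \<tau>)\<close>, where \<open>L\<^sub>i\<close> and \<open>\<tau>\<close> are subspaces of the tangent spaces at
  \<open>x\<^sub>i\<close> and \<open>y\<close>, expressed in the local trivialisation given by a chart around \<open>y\<close>.
\<close>

definition grassmann_converges ::
    "('n::topological_space, 'e::real_normed_vector) chart set \<Rightarrow>
     (nat \<Rightarrow> 'n) \<Rightarrow> (nat \<Rightarrow> ('n, 'e) tvec set) \<Rightarrow> 'n \<Rightarrow> ('n, 'e) tvec set \<Rightarrow> bool" where
  "grassmann_converges A x L y \<tau> \<longleftrightarrow>
     x \<longlonglongrightarrow> y \<and> \<tau> \<subseteq> tangent_space A y \<and>
     (\<exists>c\<in>charts_at A y. \<exists>k.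
        limitin (grassmannian k) (\<lambda>i. coord c (L i)) (coord c \<tau>) sequentially)"


section \<open>\<open>(a\<^sub>f)\<close>-regularity\<close>

definition af_regular_at ::
    "('n::topological_space, 'e::real_normed_vector) chart set \<Rightarrow>
     ('p, 'f::real_normed_vector) chart set \<Rightarrow> ('n \<Rightarrow> 'p) \<Rightarrow> 'n set \<Rightarrow> 'n set \<Rightarrow> 'n \<Rightarrow> bool" where
  "af_regular_at A B f X Y y \<longleftrightarrow>
     (\<forall>x \<tau>. (\<forall>i. x i \<in> X) \<longrightarrow>
        grassmann_converges A x (\<lambda>i. leaf_tangent A B f X (x i)) y \<tau> \<longrightarrow>
        leaf_tangent A B f Y y \<subseteq> \<tau>)"

definition af_regular_over ::
    "('n::topological_space, 'e::real_normed_vector) chart set \<Rightarrow>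
     ('p, 'f::real_normed_vector) chart set \<Rightarrow> ('n \<Rightarrow> 'p) \<Rightarrow> 'n set \<Rightarrow> 'n set \<Rightarrow> bool" where
  "af_regular_over A B f X Y \<longleftrightarrow> (\<forall>y \<in> Y \<inter> closure X. af_regular_at A B f X Y y)"

definition af_regular_pair ::
    "('n::topological_space, 'e::real_normed_vector) chart set \<Rightarrow>
     ('p, 'f::real_normed_vector) chart set \<Rightarrow> ('n \<Rightarrow> 'p) \<Rightarrow> 'n set \<Rightarrow> 'n set \<Rightarrow> bool" where
  "af_regular_pair A B f X Y \<longleftrightarrow> af_regular_over A B f X Y \<and> af_regular_over A B f Y X"

definition af_regular ::
    "('n::topological_space, 'e::real_normed_vector) chart set \<Rightarrow>
     ('p, 'f::real_normed_vector) chart set \<Rightarrow> ('n \<Rightarrow> 'p) \<Rightarrow> 'n set set \<Rightarrow> bool" where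
  "af_regular A B f \<Sigma> \<longleftrightarrow> (\<forall>X\<in>\<Sigma>. \<forall>Y\<in>\<Sigma>. af_regular_pair A B f X Y)"


section \<open>Transversality\<close>

definition tvec_sum :: "('m, 'e::real_normed_vector) tvec set \<Rightarrow> ('m, 'e) tvec set \<Rightarrow> ('m, 'e) tvec set"
  where "tvec_sum L L' = {(\<lambda>c. u c + v c) | u v. u \<in> L \<and> v \<in> L'}"

definition transverse_on ::
    "('m, 'd::real_normed_vector) chart set \<Rightarrow> ('n, 'e::real_normed_vector) chart set \<Rightarrow>
     ('p, 'f::real_normed_vector) chart set \<Rightarrow> ('n \<Rightarrow> 'p) \<Rightarrow> 'n set set \<Rightarrow>
     'm set \<Rightarrow> ('m \<Rightarrow> 'n) \<Rightarrow> bool" where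
  "transverse_on M A B f \<Sigma> K g \<longleftrightarrow>
     (\<forall>w\<in>K. \<forall>S\<in>\<Sigma>. g w \<in> S \<longrightarrow>
        tvec_sum (differential M A g w ` tangent_space M w) (leaf_tangent A B f S (g w))
          = tangent_space A (g w))"


section \<open>The weak and the strong \<open>C\<^sup>1\<close>-topology\<close>

text \<open>
  We follow Hirsch, \<open>Differential Topology\<close>, Section 2.1. A basic constraint \<open>(c, d, K, \<epsilon>)\<close> at \<open>g\<close>
  consists of charts \<open>c = (U, \<phi>)\<close> of \<open>M\<close> and \<open>d = (V, \<psi>)\<close> of \<open>N\<close>, a compact set \<open>K \<subseteq> U\<close> with
  \<open>g(K) \<subseteq> V\<close>, and \<open>\<epsilon> > 0\<close>; a map \<open>h\<close> satisfies it if \<open>h(K) \<subseteq> V\<close> and the local representatives of \<open>g\<close>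
  and \<open>h\<close> are \<open>\<epsilon>\<close>-close on \<open>\<phi>(K)\<close> together with their derivatives.
\<close>

type_synonym ('m, 'd, 'n, 'e) constraint =
  "('m, 'd) chart \<times> ('n, 'e) chart \<times> 'm set \<times> real"

definition admissible ::
    "('m::topological_space, 'd::real_normed_vector) chart set \<Rightarrow>
     ('n::topological_space, 'e::real_normed_vector) chart set \<Rightarrow>
     ('m \<Rightarrow> 'n) \<Rightarrow> ('m, 'd, 'n, 'e) constraint \<Rightarrow> bool" where
  "admissible M N g = (\<lambda>(c, d, K, \<epsilon>).
     c \<in> M \<and> d \<in> N \<and> compact K \<and> K \<subseteq> fst c \<and> g ` K \<subseteq> fst d \<and> 0 < \<epsilon>)"

definition C1_nbhd ::
    "('m::topological_space, 'd::real_normed_vector) chart set \<Rightarrow>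
     ('n::topological_space, 'e::real_normed_vector) chart set \<Rightarrow>
     ('m \<Rightarrow> 'n) \<Rightarrow> ('m, 'd, 'n, 'e) constraint \<Rightarrow> ('m \<Rightarrow> 'n) set" where
  "C1_nbhd M N g = (\<lambda>(c, d, K, \<epsilon>).
     {h \<in> C1_maps M N. h ` K \<subseteq> fst d \<and>
       (\<forall>x \<in> snd c ` K.
          norm (local_rep c d h x - local_rep c d g x) < \<epsilon> \<and>
          onorm (\<lambda>v. frechet_derivative (local_rep c d h) (at x) v
                    - frechet_derivative (local_rep c d g) (at x) v) < \<epsilon>)})"

definition weak_C1_topology ::
    "('m::topological_space, 'd::real_normed_vector) chart set \<Rightarrow>
     ('n::topological_space, 'e::real_normed_vector) chart set \<Rightarrow> ('m \<Rightarrow> 'n) topology" where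
  "weak_C1_topology M N = topology_generated_by
     {C1_nbhd M N g \<theta> | g \<theta>. g \<in> C1_maps M N \<and> admissible M N g \<theta>}"

definition locally_finite_constraints ::
    "('m::topological_space, 'd, 'n, 'e) constraint set \<Rightarrow> bool" where
  "locally_finite_constraints \<Theta> \<longleftrightarrow>
     (\<forall>p. \<exists>W. open W \<and> p \<in> W \<and> finite {\<theta>\<in>\<Theta>. fst (fst \<theta>) \<inter> W \<noteq> {}})"

definition strong_C1_topology ::
    "('m::topological_space, 'd::real_normed_vector) chart set \<Rightarrow>
     ('n::topological_space, 'e::real_normed_vector) chart set \<Rightarrow> ('m \<Rightarrow> 'n) topology" where
  "strong_C1_topology M N = topology_generated_by
     {C1_maps M N \<inter> (\<Inter>\<theta>\<in>\<Theta>. C1_nbhd M N g \<theta>) | g \<Theta>. g \<in> C1_maps M N \<and>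
        (\<forall>\<theta>\<in>\<Theta>. admissible M N g \<theta>) \<and> locally_finite_constraints \<Theta>}"

end

theory Submission
  imports Defs
begin

text \<open>
  The heart of the matter is a semicontinuity statement at a single point. Let \<open>y \<in> N\<close>, and let \<open>T\<^sub>0\<close>
  be a linear map into the tangent space at \<open>y\<close> that is transverse to the leaf through \<open>y\<close>. Then
  every linear map \<open>T\<close> close to \<open>T\<^sub>0\<close>, into the tangent space at a point \<open>x\<close> close to \<open>y\<close>, is
  transverse to the leaf through \<open>x\<close>, no matter which stratum contains \<open>x\<close>. Otherwise there are
  points \<open>x\<^sub>n \<rightarrow> y\<close> and maps \<open>T\<^sub>n \<rightarrow> T\<^sub>0\<close> that are not transverse. Since \<open>V\<close> is closed, \<open>y\<close> lies in a
  stratum \<open>Y\<close>. By local finiteness a subsequence of the \<open>x\<^sub>n\<close> stays in a single stratum \<open>X\<close>, and since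
  Grassmannians are compact, a further subsequence has leaf tangent spaces of constant
  dimension converging to some \<open>\<tau>\<close>. Now \<open>(a\<^sub>f)\<close>-regularity says that \<open>\<tau>\<close> contains the tangent space of
  the leaf at \<open>y\<close>, so \<open>T\<^sub>0\<close> is transverse to \<open>\<tau>\<close>. Being transverse to a subspace is an open condition
  on pairs consisting of a map and a frame of the subspace, so \<open>T\<^sub>n\<close> is transverse to the leaf at
  \<open>x\<^sub>n\<close> for large \<open>n\<close>, a contradiction. This is \<open>transversality_semicontinuous\<close>; its ingredients are
  \<open>grassmannian_seq_compact\<close> and \<open>chart_transverse_limit\<close>.

  From there on only continuity is used. If \<open>g\<close> is transverse at \<open>w\<close>, then near \<open>w\<close> the value and
  the derivative of any map \<open>C\<^sup>1\<close>-close to \<open>g\<close> are close to those of \<open>g\<close> at \<open>w\<close>. Hence a single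
  constraint on a compact coordinate ball around \<open>w\<close> forces transversality on that ball
  (\<open>stable_transversality_constraint\<close>). Finitely many constraints do this for a compact \<open>K\<close>, which
  proves weak openness. For a closed \<open>K\<close>, exhaust \<open>M\<close> by compact sets \<open>E\<^sub>n\<close> and treat each compact
  layer \<open>K \<inter> (E\<^sub>n\<^sub>+\<^sub>1 - interior E\<^sub>n)\<close> with finitely many constraints whose charts live near that layer.
  Together they form a locally finite family, so they define a strong neighbourhood.

  Model spaces are finite-dimensional normed spaces without a chosen inner product, so the
  required facts about them (bounded linear maps, compact balls, closed subspaces,
  compactness of Grassmannians) are derived from coordinates with respect to a basis.
\<close>

section \<open>Finite-dimensional normed spaces\<close>

lemma coefficient_subsequence:
  fixes c :: "nat \<Rightarrow> 'i \<Rightarrow> real"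
  assumes "finite I" "\<And>n i. i \<in> I \<Longrightarrow> \<bar>c n i\<bar> \<le> C"
  shows "\<exists>l r. strict_mono (r :: nat \<Rightarrow> nat) \<and> (\<forall>i\<in>I. (\<lambda>n. c (r n) i) \<longlonglongrightarrow> l i)"
  using assms
proof (induction I rule: finite_induct)
  case empty
  show ?case by (auto intro: strict_mono_id[unfolded id_def])
next
  case (insert j I)
  then obtain l r where r: "strict_mono (r :: nat \<Rightarrow> nat)" "\<And>i. i \<in> I \<Longrightarrow> (\<lambda>n. c (r n) i) \<longlonglongrightarrow> l i"
    by force
  have "bounded (range (\<lambda>n. c (r n) j))"
    using insert.prems[of j] by (auto intro!: boundedI)
  then obtain a s where s: "strict_mono (s :: nat \<Rightarrow> nat)" "((\<lambda>n. c (r n) j) \<circ> s) \<longlonglongrightarrow> a"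
    using bounded_imp_convergent_subsequence by blast
  have "(\<lambda>n. c ((r \<circ> s) n) i) \<longlonglongrightarrow> (l(j := a)) i" if "i \<in> insert j I" for i
    using that s LIMSEQ_subseq_LIMSEQ[OF r(2) s(1), of i] insert.hyps by (auto simp: o_def)
  then show ?case
    using strict_mono_o[OF r(1) s(1)] by blast
qed

text \<open>
  The bound says that coefficients depend continuously on the vector that they represent; all
  topological facts about finite-dimensional spaces below rest on it. If it failed, normalised
  coefficient families would give combinations tending to \<open>0\<close>, and a limit of the coefficients would
  be a nontrivial relation.
\<close>

lemma independent_family_lower_bound:
  fixes v :: "'i \<Rightarrow> 'e::real_normed_vector"
  assumes "finite I"
    and indep: "\<And>c. (\<Sum>i\<in>I. c i *\<^sub>R v i) = 0 \<Longrightarrow> \<forall>i\<in>I. c i = 0"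
  shows "\<exists>m>0. \<forall>c. m * (\<Sum>i\<in>I. \<bar>c i\<bar>) \<le> norm (\<Sum>i\<in>I. c i *\<^sub>R v i)"
proof (rule ccontr)
  assume neg: "\<not> ?thesis"
  have "\<exists>c. norm (\<Sum>i\<in>I. c i *\<^sub>R v i) < 1 / real (Suc n) * (\<Sum>i\<in>I. \<bar>c i\<bar>)" for n
  proof -
    have "0 < 1 / real (Suc n)" by simp
    then have "\<not> (\<forall>c. 1 / real (Suc n) * (\<Sum>i\<in>I. \<bar>c i\<bar>) \<le> norm (\<Sum>i\<in>I. c i *\<^sub>R v i))"
      using neg by blast
    then show ?thesis by (simp only: not_le not_all)
  qed
  then obtain c where c: "\<And>n. norm (\<Sum>i\<in>I. c n i *\<^sub>R v i) < 1 / real (Suc n) * (\<Sum>i\<in>I. \<bar>c n i\<bar>)"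
    by metis
  define a where "a n = (\<Sum>i\<in>I. \<bar>c n i\<bar>)" for n
  have a: "a n > 0" for n
  proof -
    have "0 < 1 / real (Suc n) * a n"
      using c[of n] norm_ge_zero[of "\<Sum>i\<in>I. c n i *\<^sub>R v i"] unfolding a_def by linarith
    then show ?thesis by (simp add: zero_less_mult_iff zero_less_divide_iff)
  qed
  define e where "e n i = c n i / a n" for n i
  have e_sum: "(\<Sum>i\<in>I. \<bar>e n i\<bar>) = 1" for n
  proof -
    have "(\<Sum>i\<in>I. \<bar>e n i\<bar>) = (\<Sum>i\<in>I. \<bar>c n i\<bar> / a n)"
      using a[of n] by (simp add: e_def)
    also have "\<dots> = a n / a n"
      by (simp only: a_def sum_divide_distrib)
    finally show ?thesis using a[of n] by simp
  qed
  have e_small: "norm (\<Sum>i\<in>I. e n i *\<^sub>R v i) \<le> 1 / real (Suc n)" for n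
  proof -
    have "(\<Sum>i\<in>I. e n i *\<^sub>R v i) = (1 / a n) *\<^sub>R (\<Sum>i\<in>I. c n i *\<^sub>R v i)"
      by (simp add: e_def scaleR_sum_right mult.commute)
    then have "norm (\<Sum>i\<in>I. e n i *\<^sub>R v i) = norm (\<Sum>i\<in>I. c n i *\<^sub>R v i) / a n"
      using a[of n] by simp
    also have "\<dots> \<le> 1 / real (Suc n)"
      using c[of n] a[of n] by (simp add: pos_divide_le_eq a_def)
    finally show ?thesis .
  qed
  have "\<bar>e n i\<bar> \<le> 1" if "i \<in> I" for n i
    using member_le_sum[of i I "\<lambda>i. \<bar>e n i\<bar>"] that assms(1) e_sum[of n] by auto
  then obtain l r where r: "strict_mono (r :: nat \<Rightarrow> nat)"
    and l: "\<And>i. i \<in> I \<Longrightarrow> (\<lambda>n. e (r n) i) \<longlonglongrightarrow> l i"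
    using coefficient_subsequence[of I e 1] assms(1) by blast
  have "(\<lambda>n. \<Sum>i\<in>I. \<bar>e (r n) i\<bar>) \<longlonglongrightarrow> (\<Sum>i\<in>I. \<bar>l i\<bar>)"
    by (intro tendsto_intros l)
  then have l_sum: "(\<Sum>i\<in>I. \<bar>l i\<bar>) = 1"
    by (simp add: e_sum LIMSEQ_const_iff)
  have "(\<lambda>n. norm (\<Sum>i\<in>I. e (r n) i *\<^sub>R v i)) \<longlonglongrightarrow> norm (\<Sum>i\<in>I. l i *\<^sub>R v i)"
    by (intro tendsto_intros l)
  moreover have "(\<lambda>n. norm (\<Sum>i\<in>I. e (r n) i *\<^sub>R v i)) \<longlonglongrightarrow> 0"
  proof (rule tendsto_sandwich[OF _ _ tendsto_const])
    show "(\<lambda>n. 1 / real (Suc (r n))) \<longlonglongrightarrow> 0"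
      using LIMSEQ_subseq_LIMSEQ[OF LIMSEQ_inverse_real_of_nat r] by (simp add: o_def inverse_eq_divide)
  qed (use e_small in auto)
  ultimately have "norm (\<Sum>i\<in>I. l i *\<^sub>R v i) = 0"
    by (rule LIMSEQ_unique)
  then show False
    using indep[of l] l_sum by simp
qed

text \<open>
  Moving each vector by at most half of the lower bound changes a linear combination by at most half
  of its guaranteed size, so it stays nonzero.
\<close>

lemma independent_family_perturbation:
  fixes v :: "'i \<Rightarrow> 'e::real_normed_vector"
  assumes "finite I"
    and indep: "\<And>c. (\<Sum>i\<in>I. c i *\<^sub>R v i) = 0 \<Longrightarrow> \<forall>i\<in>I. c i = 0"
  shows "\<exists>\<delta>>0. \<forall>u c. (\<forall>i\<in>I. norm (u i - v i) \<le> \<delta>) \<longrightarrow> (\<Sum>i\<in>I. c i *\<^sub>R u i) = 0 \<longrightarrow> (\<forall>i\<in>I. c i = 0)"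
proof -
  obtain m where m: "m > 0" "\<And>c. m * (\<Sum>i\<in>I. \<bar>c i\<bar>) \<le> norm (\<Sum>i\<in>I. c i *\<^sub>R v i)"
    using independent_family_lower_bound[OF assms] by blast
  have "\<forall>i\<in>I. c i = 0" if u: "\<forall>i\<in>I. norm (u i - v i) \<le> m / 2" and z: "(\<Sum>i\<in>I. c i *\<^sub>R u i) = 0" for u c
  proof -
    have "m * (\<Sum>i\<in>I. \<bar>c i\<bar>) \<le> norm (\<Sum>i\<in>I. c i *\<^sub>R (u i - v i))"
      using m(2)[of c] z by (simp add: scaleR_diff_right sum_subtractf)
    also have "\<dots> \<le> (\<Sum>i\<in>I. \<bar>c i\<bar> * (m / 2))"
    proof (rule sum_norm_le)
      fix i assume "i \<in> I"
      then have "\<bar>c i\<bar> * norm (u i - v i) \<le> \<bar>c i\<bar> * (m / 2)"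
        using u by (intro mult_left_mono) auto
      then show "norm (c i *\<^sub>R (u i - v i)) \<le> \<bar>c i\<bar> * (m / 2)"
        by simp
    qed
    also have "\<dots> = m / 2 * (\<Sum>i\<in>I. \<bar>c i\<bar>)"
      by (subst sum_distrib_right[symmetric]) (rule mult.commute)
    finally have "(\<Sum>i\<in>I. \<bar>c i\<bar>) \<le> 0"
      using m(1) by (simp add: mult_le_cancel_right)
    then have "(\<Sum>i\<in>I. \<bar>c i\<bar>) = 0"
      by (simp add: order_antisym sum_nonneg)
    then show ?thesis
      using sum_nonneg_eq_0_iff[OF assms(1), of "\<lambda>i. \<bar>c i\<bar>"] by simp
  qed
  then show ?thesis
    using m(1) by (intro exI[of _ "m / 2"]) auto
qed

text \<open>
  A basis is fixed in order to have coordinates; since \<open>0\<close>-dimensional spaces have to be covered, the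
  class of Euclidean spaces cannot be used instead.
\<close>

locale finite_basis =
  fixes B :: "'e::real_normed_vector set"
  assumes finite_B: "finite B" and independent_B: "independent B" and span_B: "span B = UNIV"
begin

sublocale fd: finite_dimensional_vector_space "scaleR :: real \<Rightarrow> 'e \<Rightarrow> 'e" B
  rewrites "module.dependent (*\<^sub>R) = dependent"
    and "module.representation (*\<^sub>R) = representation"
    and "module.subspace (*\<^sub>R) = subspace"
    and "module.span (*\<^sub>R) = span"
    and "vector_space.extend_basis (*\<^sub>R) = extend_basis"
    and "vector_space.dim (*\<^sub>R) = dim"
  using finite_B independent_B span_B
  by unfold_locales
    (auto simp: dependent_raw_def representation_raw_def subspace_raw_def span_raw_def
      extend_basis_raw_def dim_raw_def)

lemma sum_coordinates: "(\<Sum>b\<in>B. representation B x b *\<^sub>R b) = x"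
  using sum_representation_eq[OF independent_B _ finite_B] span_B by auto

lemma representation_linear: "linear (\<lambda>x. representation B x b)"
  by (rule linearI) (simp_all add: representation_add representation_scale independent_B span_B)

lemma coordinates_lower_bound:
  obtains m where "m > 0" "\<And>x. m * (\<Sum>b\<in>B. \<bar>representation B x b\<bar>) \<le> norm x"
proof -
  have "\<forall>b\<in>B. c b = 0" if "(\<Sum>b\<in>B. c b *\<^sub>R b) = 0" for c
    using independent_B that by (auto simp: dependent_finite[OF finite_B])
  then obtain m where "m > 0" "\<And>c. m * (\<Sum>b\<in>B. \<bar>c b\<bar>) \<le> norm (\<Sum>b\<in>B. c b *\<^sub>R b)"
    using independent_family_lower_bound[OF finite_B, of "\<lambda>b. b"] by blast
  then show ?thesis
    using that sum_coordinates by metis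
qed

lemma linear_imp_bounded_linear:
  fixes h :: "'e \<Rightarrow> 'f::real_normed_vector"
  assumes "linear h"
  shows "bounded_linear h"
proof -
  obtain m where m: "m > 0" "\<And>x. m * (\<Sum>b\<in>B. \<bar>representation B x b\<bar>) \<le> norm x"
    using coordinates_lower_bound by metis
  define C where "C = (\<Sum>b\<in>B. norm (h b))"
  have "norm (h x) \<le> norm x * (C / m)" for x
  proof -
    have "h x = (\<Sum>b\<in>B. representation B x b *\<^sub>R h b)"
    proof -
      have "h x = h (\<Sum>b\<in>B. representation B x b *\<^sub>R b)"
        by (simp only: sum_coordinates)
      then show ?thesis
        by (simp add: linear_sum[OF assms] linear_scale[OF assms])
    qed
    also have "norm \<dots> \<le> (\<Sum>b\<in>B. \<bar>representation B x b\<bar> * C)"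
      by (rule sum_norm_le)
        (auto simp: C_def finite_B intro!: mult_left_mono member_le_sum[where f = "\<lambda>b. norm (h b)"])
    also have "\<dots> = (\<Sum>b\<in>B. \<bar>representation B x b\<bar>) * C"
      by (simp add: sum_distrib_right)
    also have "\<dots> \<le> (norm x / m) * C"
      using m by (intro mult_right_mono) (auto simp: C_def field_simps sum_nonneg)
    finally show ?thesis by simp
  qed
  then show ?thesis
    using assms by (intro bounded_linear_intro[where K = "C / m"]) (auto simp: linear_add linear_scale)
qed

lemma tendsto_coordinates: "x \<longlonglongrightarrow> a \<Longrightarrow> (\<lambda>n. representation B (x n) b) \<longlonglongrightarrow> representation B a b"
  by (rule bounded_linear.tendsto[OF linear_imp_bounded_linear[OF representation_linear]])

lemma convergent_subsequence_of_coordinates: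
  assumes "\<And>n b. b \<in> B \<Longrightarrow> \<bar>representation B (x n) b\<bar> \<le> C"
  obtains r a where "strict_mono (r :: nat \<Rightarrow> nat)" "(\<lambda>n. x (r n)) \<longlonglongrightarrow> a"
proof -
  obtain l r where r: "strict_mono (r :: nat \<Rightarrow> nat)"
    "\<And>b. b \<in> B \<Longrightarrow> (\<lambda>n. representation B (x (r n)) b) \<longlonglongrightarrow> l b"
    using coefficient_subsequence[of B "\<lambda>n. representation B (x n)", OF finite_B assms] by blast
  have "(\<lambda>n. \<Sum>b\<in>B. representation B (x (r n)) b *\<^sub>R b) \<longlonglongrightarrow> (\<Sum>b\<in>B. l b *\<^sub>R b)"
    by (intro tendsto_intros r)
  then show ?thesis
    using that r(1) by (simp add: sum_coordinates)
qed

lemma compact_cball: "compact (cball (a :: 'e) \<rho>)"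
  unfolding compact_eq_seq_compact_metric seq_compact_def
proof (intro allI impI)
  fix x :: "nat \<Rightarrow> 'e"
  assume x: "\<forall>n. x n \<in> cball a \<rho>"
  obtain m where m: "m > 0" "\<And>x. m * (\<Sum>b\<in>B. \<bar>representation B x b\<bar>) \<le> norm x"
    using coordinates_lower_bound by metis
  have "\<bar>representation B (x n) b\<bar> \<le> (norm a + \<rho>) / m" if "b \<in> B" for n b
  proof -
    have "\<bar>representation B (x n) b\<bar> \<le> (\<Sum>b\<in>B. \<bar>representation B (x n) b\<bar>)"
      using that finite_B by (intro member_le_sum) auto
    moreover have "norm (x n) \<le> norm a + \<rho>"
      using x norm_triangle_sub[of "x n" a] by (auto simp: dist_norm norm_minus_commute intro: order_trans)
    moreover have "(\<Sum>b\<in>B. \<bar>representation B (x n) b\<bar>) \<le> norm (x n) / m"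
      using m(2)[of "x n"] m(1) by (simp add: pos_le_divide_eq mult.commute)
    moreover have "norm (x n) / m \<le> (norm a + \<rho>) / m"
      using calculation(2) m(1) by (simp add: divide_right_mono)
    ultimately show ?thesis
      by linarith
  qed
  then obtain r l where r: "strict_mono (r :: nat \<Rightarrow> nat)" "(\<lambda>n. x (r n)) \<longlonglongrightarrow> l"
    by (rule convergent_subsequence_of_coordinates)
  moreover have "l \<in> cball a \<rho>"
    using closed_sequentially[OF closed_cball _ r(2)] x by blast
  ultimately show "\<exists>l\<in>cball a \<rho>. \<exists>r. strict_mono r \<and> (x \<circ> r) \<longlonglongrightarrow> l"
    by (auto simp: o_def)
qed

text \<open>
  Extend a basis of the subspace to a basis of the whole space: the subspace is the
  common zero set of the remaining coordinates, which are continuous.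
\<close>

lemma closed_subspace:
  assumes "subspace (E :: 'e set)"
  shows "closed E"
proof -
  obtain C where C: "C \<subseteq> E" "independent C" "E \<subseteq> span C"
    using maximal_independent_subset[of E] by metis
  define D where "D = extend_basis C"
  have D: "C \<subseteq> D" "independent D" "span D = UNIV"
    unfolding D_def using C(2)
    by (auto simp: extend_basis_superset independent_extend_basis span_extend_basis)
  interpret D: finite_basis D
    using fd.finiteI_independent[OF D(2)] D by unfold_locales auto
  have "E = (\<Inter>b\<in>D - C. {x. representation D x b = 0})"
  proof (intro equalityI subsetI INT_I CollectI)
    fix x b assume "x \<in> E" "b \<in> D - C"
    then show "representation D x b = 0"
      using representation_extend[OF D(2) subsetD[OF C(3)] D(1)] representation_ne_zero[of C x b]
      by (metis DiffD2)
  next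
    fix x assume x: "x \<in> (\<Inter>b\<in>D - C. {x. representation D x b = 0})"
    have "x = (\<Sum>b\<in>D. representation D x b *\<^sub>R b)"
      by (simp add: D.sum_coordinates)
    also have "\<dots> \<in> span C"
    proof (rule span_sum)
      fix b assume "b \<in> D"
      then show "representation D x b *\<^sub>R b \<in> span C"
        using x by (cases "b \<in> C") (auto simp: span_base span_scale span_zero)
    qed
    also have "span C \<subseteq> E"
      using C(1) assms by (rule span_minimal)
    finally show "x \<in> E" .
  qed
  moreover have "closed {x. representation D x b = 0}" for b
    by (rule closed_Collect_eq)
      (auto intro!: linear_continuous_on D.linear_imp_bounded_linear D.representation_linear)
  ultimately show ?thesis by auto
qed

text \<open>
  A perturbed basis is still independent, hence still spans because its number of elements is the
  dimension.
\<close>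

lemma spanning_perturbation:
  obtains \<delta> where "\<delta> > 0" "\<And>u. (\<forall>b\<in>B. norm (u b - b) \<le> \<delta>) \<Longrightarrow> span (u ` B) = UNIV"
proof -
  have *: "\<forall>b\<in>B. c b = 0" if "(\<Sum>b\<in>B. c b *\<^sub>R b) = 0" for c
    using independent_B that by (auto simp: dependent_finite[OF finite_B])
  obtain \<delta> where \<delta>: "\<delta> > 0" "\<And>u c. (\<forall>b\<in>B. norm (u b - b) \<le> \<delta>) \<Longrightarrow>
      (\<Sum>b\<in>B. c b *\<^sub>R u b) = 0 \<Longrightarrow> \<forall>b\<in>B. c b = 0"
    using independent_family_perturbation[OF finite_B, of "\<lambda>b. b", OF *] by blast
  have "span (u ` B) = UNIV" if u: "\<forall>b\<in>B. norm (u b - b) \<le> \<delta>" for u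
  proof -
    have inj: "inj_on u B"
    proof (rule inj_onI, rule ccontr)
      fix a b assume ab: "a \<in> B" "b \<in> B" "u a = u b" "a \<noteq> b"
      \<comment> \<open>coinciding perturbed vectors would satisfy the relation \<open>u a - u b = 0\<close>\<close>
      let ?c = "\<lambda>x. if x = a then 1 else if x = b then - 1 else (0::real)"
      have "(\<Sum>x\<in>B. ?c x *\<^sub>R u x) = (\<Sum>x\<in>{a, b}. ?c x *\<^sub>R u x)"
        using ab finite_B by (intro sum.mono_neutral_right) auto
      also have "\<dots> = 0" using ab by simp
      finally show False using \<delta>(2)[OF u] ab(1) by force
    qed
    have "independent (u ` B)"
    proof
      assume "dependent (u ` B)"
      then obtain c v where c: "v \<in> B" "c (u v) \<noteq> 0" "(\<Sum>y\<in>u ` B. c y *\<^sub>R y) = 0"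
        by (auto simp: dependent_finite finite_B)
      then have "(\<Sum>b\<in>B. c (u b) *\<^sub>R u b) = 0"
        by (simp add: sum.reindex[OF inj] o_def)
      then show False using \<delta>(2)[OF u, of "\<lambda>b. c (u b)"] c by blast
    qed
    moreover have "dim (UNIV :: 'e set) \<le> card (u ` B)"
      by (simp add: card_image[OF inj] fd.dim_UNIV fd.dimension_def)
    ultimately show ?thesis
      using fd.card_ge_dim_independent[of "u ` B" UNIV] by auto
  qed
  with that \<delta>(1) show ?thesis by blast
qed

section \<open>Sequential compactness of Grassmannians\<close>

text \<open>
  Take any nonzero vector of \<open>L\<close> and divide it by its coordinate of largest absolute value.
\<close>

lemma pivot_vector:
  assumes "subspace L" "dim L = Suc k"
  obtains x j where "x \<in> L" "j \<in> B" "representation B x j = 1" "\<And>b. b \<in> B \<Longrightarrow> \<bar>representation B x b\<bar> \<le> 1"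
proof -
  have "\<not> L \<subseteq> {0}"
    using assms(2) fd.dim_eq_0 by (metis Zero_not_Suc)
  then obtain z where z: "z \<in> L" "z \<noteq> 0" by blast
  have nz: "\<not> (\<forall>b\<in>B. representation B z b = 0)"
    using sum_coordinates[of z] z(2) sum.neutral[of B "\<lambda>b. representation B z b *\<^sub>R b"] by force
  then have "B \<noteq> {}" by auto
  then have M: "Max ((\<lambda>b. \<bar>representation B z b\<bar>) ` B) \<in> (\<lambda>b. \<bar>representation B z b\<bar>) ` B"
    using finite_B by (intro Max_in) auto
  then obtain j where j: "j \<in> B" "Max ((\<lambda>b. \<bar>representation B z b\<bar>) ` B) = \<bar>representation B z j\<bar>"
    by blast
  have j_max: "\<bar>representation B z b\<bar> \<le> \<bar>representation B z j\<bar>" if "b \<in> B" for b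
    unfolding j(2)[symmetric] using finite_B that by (intro Max_ge) auto
  obtain b where "b \<in> B" "representation B z b \<noteq> 0"
    using nz by blast
  then have j0: "representation B z j \<noteq> 0"
    using j_max[of b] by auto
  define x where "x = (1 / representation B z j) *\<^sub>R z"
  have x: "representation B x b = representation B z b / representation B z j" for b
    by (simp add: x_def representation_scale independent_B span_B)
  show ?thesis
  proof (rule that[of x j])
    show "x \<in> L" using z(1) assms(1) by (simp add: x_def subspace_scale)
  qed (use j(1) j0 j_max in \<open>auto simp: x abs_divide divide_le_eq_1\<close>)
qed

text \<open>
  One step of Gaussian elimination: subtracting a multiple of \<open>x\<close> makes the pivot coordinate vanish.
\<close>

lemma pivot_decomposition:
  assumes "subspace L" "dim L = Suc k" "x \<in> L" "representation B x j = 1"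
  defines "L' \<equiv> L \<inter> {u. representation B u j = 0}"
  shows "subspace L'" "dim L' = k" "span (insert x L') = L"
proof -
  note lin = representation_linear[of j]
  show L': "subspace L'"
    unfolding L'_def using assms(1) linear_subspace_kernel[OF lin] by (rule subspace_inter)
  show sp: "span (insert x L') = L"
  proof
    show "span (insert x L') \<subseteq> L"
      using assms(1,3) by (intro span_minimal) (auto simp: L'_def)
    show "L \<subseteq> span (insert x L')"
    proof
      fix u assume u: "u \<in> L"
      let ?a = "representation B u j"
      have "u - ?a *\<^sub>R x \<in> L'"
        using u assms(1,3,4) linear_diff[OF lin] linear_scale[OF lin]
        by (auto simp: L'_def subspace_diff subspace_scale)
      then show "u \<in> span (insert x L')"
        by (meson span_base span_breakdown_eq)
    qed
  qed
  have "x \<notin> span L'"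
    using assms(4) L' by (simp add: span_eq_iff[THEN iffD2] L'_def)
  then show "dim L' = k"
    using fd.dim_insert[of x L'] sp assms(2) dim_span[of "insert x L'"] by simp
qed

text \<open>
  Gaussian elimination with complete pivoting replaces orthonormal frames. Each \<open>L n\<close> is the sum of
  the line through a pivot vector and the subspace on which the pivot coordinate vanishes. Along a
  subsequence the pivot index is constant and the pivot vectors, whose coordinates are bounded by
  \<open>1\<close>, converge; the subspaces of dimension \<open>k\<close> are handled by induction. The limit of the frames is
  independent because the limit of the pivot vectors has pivot coordinate \<open>1\<close> whereas the other limit
  vectors have pivot coordinate \<open>0\<close>.
\<close>

lemma grassmannian_seq_compact:
  fixes L :: "nat \<Rightarrow> 'e set"
  assumes "\<And>n. subspace (L n)" "\<And>n. dim (L n) = k"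
  shows "\<exists>r \<beta> b. strict_mono (r :: nat \<Rightarrow> nat) \<and>
    (\<forall>n. \<beta> n \<in> frames k \<and> span (\<beta> n ` {..<k}) = L (r n)) \<and>
    b \<in> frames k \<and> (\<forall>i<k. (\<lambda>n. \<beta> n i) \<longlonglongrightarrow> b i)"
  using assms
proof (induction k arbitrary: L)
  case 0
  have L0: "L n = {0}" for n
    using fd.dim_eq_0[of "L n"] subspace_0[OF 0(1)] 0(2)[of n] by blast
  show ?case
  proof (intro exI conjI allI impI)
    show "strict_mono (\<lambda>n :: nat. n)" by (simp add: strict_mono_def)
  qed (simp_all add: frames_def L0 independent_empty)
next
  case (Suc k)
  have "\<exists>x j. x \<in> L n \<and> j \<in> B \<and> representation B x j = 1 \<and> (\<forall>b\<in>B. \<bar>representation B x b\<bar> \<le> 1)" for n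
    by (rule pivot_vector[OF Suc.prems(1)[of n] Suc.prems(2)[of n]]) blast
  then obtain x J where x: "\<And>n. x n \<in> L n" "\<And>n. J n \<in> B" "\<And>n. representation B (x n) (J n) = 1"
    "\<And>n b. b \<in> B \<Longrightarrow> \<bar>representation B (x n) b\<bar> \<le> 1"
    by metis
  have "finite (range J)"
    using x(2) by (intro finite_subset[OF _ finite_B]) auto
  then obtain j where "infinite {n. J n = j}"
    using pigeonhole_infinite[of UNIV J] by auto
  then obtain r1 where r1: "strict_mono (r1 :: nat \<Rightarrow> nat)" "\<And>n. J (r1 n) = j"
    using infinite_enumerate[of "{n. J n = j}"] by blast
  obtain r2 a where r2: "strict_mono (r2 :: nat \<Rightarrow> nat)" "(\<lambda>n. x (r1 (r2 n))) \<longlonglongrightarrow> a"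
    using convergent_subsequence_of_coordinates[of "x \<circ> r1" 1] x(4) by auto
  define L' where "L' n = L (r1 (r2 n)) \<inter> {u. representation B u j = 0}" for n
  have xj: "representation B (x (r1 (r2 n))) j = 1" for n
    using x(3)[of "r1 (r2 n)"] r1(2) by simp
  note L' = pivot_decomposition[OF Suc.prems(1,2) x(1) xj, folded L'_def]
  obtain r3 \<beta> b where IH: "strict_mono (r3 :: nat \<Rightarrow> nat) \<and>
      (\<forall>n. \<beta> n \<in> frames k \<and> span (\<beta> n ` {..<k}) = L' (r3 n)) \<and>
      b \<in> frames k \<and> (\<forall>i<k. (\<lambda>n. \<beta> n i) \<longlonglongrightarrow> b i)"
    using Suc.IH[of L', OF L'(1,2)] by (elim exE) (rule that)
  then have r3: "strict_mono r3"
    and \<beta>: "\<And>n. \<beta> n \<in> frames k" "\<And>n. span (\<beta> n ` {..<k}) = L' (r3 n)"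
    and b: "b \<in> frames k" "\<And>i. i < k \<Longrightarrow> (\<lambda>n. \<beta> n i) \<longlonglongrightarrow> b i"
    by auto
  have extend: "v(k := z) \<in> frames (Suc k)" if "v \<in> frames k" "z \<notin> span (v ` {..<k})" for v and z :: 'e
  proof -
    have "z \<notin> v ` {..<k}" using that(2) span_superset[of "v ` {..<k}"] by auto
    moreover have "(v(k := z)) ` {..<Suc k} = insert z (v ` {..<k})"
      by (auto simp: lessThan_Suc image_iff)
    moreover have "inj_on (v(k := z)) {..<Suc k}"
      using that(1) \<open>z \<notin> v ` {..<k}\<close> by (auto simp: frames_def lessThan_Suc inj_on_def)
    moreover have "v(k := z) \<in> {..<Suc k} \<rightarrow>\<^sub>E UNIV"
      using that(1) by (auto simp: frames_def PiE_iff extensional_def)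
    ultimately show ?thesis
      using that by (simp add: frames_def independent_insertI)
  qed
  have img: "(v(k := z)) ` {..<Suc k} = insert z (v ` {..<k})" for v and z :: 'e
    by (auto simp: lessThan_Suc image_iff)
  \<comment> \<open>append the pivot vector to the frame of the hyperplane section\<close>
  let ?r = "r1 \<circ> r2 \<circ> r3"
  let ?\<beta> = "\<lambda>n. (\<beta> n)(k := x (?r n))"
  have "?\<beta> n \<in> frames (Suc k)" for n
  proof (rule extend[OF \<beta>(1)])
    show "x (?r n) \<notin> span (\<beta> n ` {..<k})"
      by (simp add: \<beta>(2) L'_def xj)
  qed
  moreover have "span (?\<beta> n ` {..<Suc k}) = L (?r n)" for n
  proof -
    have "span (?\<beta> n ` {..<Suc k}) = span (insert (x (?r n)) (span (\<beta> n ` {..<k})))"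
      by (simp only: img span_insert span_span)
    then show ?thesis
      using L'(3) by (simp add: \<beta>(2))
  qed
  moreover have "b(k := a) \<in> frames (Suc k)"
  proof (rule extend[OF b(1)])
    have "representation B (b i) j = 0" if "i < k" for i
    proof -
      have "representation B (\<beta> n i) j = 0" for n
        using \<beta>(2)[of n] span_base[of "\<beta> n i" "\<beta> n ` {..<k}"] that by (auto simp: L'_def)
      then show ?thesis
        using tendsto_coordinates[OF b(2)[OF that], of j] by (simp add: LIMSEQ_const_iff)
    qed
    then have "span (b ` {..<k}) \<subseteq> {u. representation B u j = 0}"
      by (intro span_minimal linear_subspace_kernel[OF representation_linear]) auto
    moreover have "representation B a j = 1"
      using tendsto_coordinates[OF r2(2), of j] xj by (simp add: LIMSEQ_const_iff)
    ultimately show "a \<notin> span (b ` {..<k})" by auto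
  qed
  moreover have "(\<lambda>n. ?\<beta> n i) \<longlonglongrightarrow> (b(k := a)) i" if "i < Suc k" for i
    using that b(2)[of i] LIMSEQ_subseq_LIMSEQ[OF r2(2) r3] by (auto simp: o_def less_Suc_eq)
  moreover have "strict_mono ?r"
    using r1(1) r2(1) r3 by (simp add: strict_mono_o)
  ultimately show ?case
    by (intro exI[of _ ?r] exI[of _ ?\<beta>] exI[of _ "b(k := a)"]) blast
qed

end

lemma finite_basis_exists:
  fixes S :: "'e::real_normed_vector set"
  assumes "finite S" "span S = UNIV"
  obtains B :: "'e set" where "finite_basis B"
proof -
  obtain B where B: "B \<subseteq> S" "independent B" "S \<subseteq> span B"
    using maximal_independent_subset[of S] by metis
  have "span B = UNIV"
    using B(3) assms(2) span_mono[of S "span B"] by (auto simp: span_span)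
  with B assms(1) show ?thesis
    by (intro that[of B]) (auto simp: finite_basis_def finite_subset)
qed

text \<open>
  The map from frames to their spans is continuous by the definition of the quotient topology.
\<close>

lemma limitin_grassmannian:
  assumes "\<And>n. \<beta> n \<in> frames k" "b \<in> frames k" "\<And>i. i < k \<Longrightarrow> (\<lambda>n. \<beta> n i) \<longlonglongrightarrow> b i"
  shows "limitin (grassmannian k) (\<lambda>n. span (\<beta> n ` {..<k})) (span (b ` {..<k})) sequentially"
proof -
  have lim: "limitin (frame_topology k) \<beta> b sequentially"
    using assms unfolding frame_topology_def
    by (auto simp: limitin_subtopology limitin_componentwise frames_def PiE_iff limitin_canonical_iff)
  have top: "topspace (frame_topology k) = frames k"
    by (auto simp: frame_topology_def frames_def)
  show ?thesis
    unfolding limitin_def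
  proof (intro conjI allI impI)
    have "openin (grassmannian k) ((\<lambda>b. span (b ` {..<k})) ` (frames k :: (nat \<Rightarrow> 'a) set))"
    proof -
      have "{b \<in> frames k. span (b ` {..<k}) \<in> (\<lambda>b. span (b ` {..<k})) ` (frames k :: (nat \<Rightarrow> 'a) set)}
          = topspace (frame_topology k)"
        using top by blast
      then show ?thesis
        unfolding openin_grassmannian by (metis openin_topspace order_refl)
    qed
    then show "span (b ` {..<k}) \<in> topspace (grassmannian k)"
      using assms(2) openin_subset by blast
  next
    fix U assume U: "openin (grassmannian k) U \<and> span (b ` {..<k}) \<in> U"
    then have "openin (frame_topology k) {b \<in> frames k. span (b ` {..<k}) \<in> U}"
      by (simp add: openin_grassmannian)
    then have "\<forall>\<^sub>F n in sequentially. \<beta> n \<in> {b \<in> frames k. span (b ` {..<k}) \<in> U}"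
      using lim U assms(2) unfolding limitin_def by blast
    then show "\<forall>\<^sub>F n in sequentially. span (\<beta> n ` {..<k}) \<in> U"
      by (rule eventually_mono) auto
  qed
qed

section \<open>Charts and \<open>C\<^sup>1\<close>-calculus\<close>

lemma C1_on_has_derivative:
  assumes "C1_on W h" "x \<in> W"
  shows "(h has_derivative frechet_derivative h (at x)) (at x)"
  using assms unfolding C1_on_def by (metis frechet_derivative_at)

text \<open>
  Continuity of the derivative as an estimate on each vector, the form in which linear maps are compared
  below.
\<close>

lemma C1_on_derivative_close:
  assumes "C1_on W h" "open W" "a \<in> W" "\<epsilon> > 0"
  shows "\<exists>\<delta>>0. \<forall>x. dist x a < \<delta> \<longrightarrow> x \<in> W \<and>
    (\<forall>v. norm (frechet_derivative h (at x) v - frechet_derivative h (at a) v) \<le> \<epsilon> * norm v)"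
proof -
  obtain h' where h': "\<And>x. x \<in> W \<Longrightarrow> (h has_derivative blinfun_apply (h' x)) (at x)" "continuous_on W h'"
    using assms(1) unfolding C1_on_def by metis
  have D: "frechet_derivative h (at x) = blinfun_apply (h' x)" if "x \<in> W" for x
    using frechet_derivative_at[OF h'(1)[OF that]] by simp
  obtain \<delta>1 where \<delta>1: "\<delta>1 > 0" "\<And>x. dist x a < \<delta>1 \<Longrightarrow> x \<in> W"
    using assms(2,3) by (metis open_dist)
  obtain \<delta>2 where \<delta>2: "\<delta>2 > 0" "\<And>x. x \<in> W \<Longrightarrow> dist x a < \<delta>2 \<Longrightarrow> dist (h' x) (h' a) < \<epsilon>"
    using h'(2) assms(3,4) unfolding continuous_on_iff by metis
  have "norm (frechet_derivative h (at x) v - frechet_derivative h (at a) v) \<le> \<epsilon> * norm v"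
    if "dist x a < min \<delta>1 \<delta>2" for x v
  proof -
    have "x \<in> W" using \<delta>1(2) that by simp
    then have "norm (h' x - h' a) \<le> \<epsilon>"
      using \<delta>2(2)[of x] that by (simp add: dist_norm)
    then have "norm (blinfun_apply (h' x - h' a) v) \<le> \<epsilon> * norm v"
      by (meson norm_blinfun mult_right_mono norm_ge_zero order_trans)
    then show ?thesis
      using D[OF \<open>x \<in> W\<close>] D[OF assms(3)] by (simp add: blinfun.diff_left)
  qed
  then show ?thesis
    using \<delta>1 \<delta>2(1) by (intro exI[of _ "min \<delta>1 \<delta>2"]) auto
qed

lemma C1_on_subset: "C1_on W h \<Longrightarrow> W' \<subseteq> W \<Longrightarrow> C1_on W' h"
  unfolding C1_on_def by (meson continuous_on_subset subsetD)

lemma C1_on_cong: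
  assumes "C1_on W h" "open W" "\<And>x. x \<in> W \<Longrightarrow> h x = k x"
  shows "C1_on W k"
  using assms unfolding C1_on_def by (meson has_derivative_transform_within_open)

text \<open>
  The directional derivative is a limit of difference quotients, which lie in the subspace.
\<close>

lemma derivative_in_closed_subspace:
  fixes \<phi> :: "'a::real_normed_vector \<Rightarrow> 'b::real_normed_vector"
  assumes D: "(\<phi> has_derivative D) (at a)" and E: "closed E" "subspace E" "\<phi> a \<in> E"
    and ev: "\<forall>\<^sub>F t in at (0 :: real). \<phi> (a + t *\<^sub>R e) \<in> E"
  shows "D e \<in> E"
proof -
  have "((\<lambda>t. a + t *\<^sub>R e) has_derivative (\<lambda>t. t *\<^sub>R e)) (at (0 :: real))"
    by (auto intro!: derivative_eq_intros)
  moreover have "(\<phi> has_derivative D) (at (a + 0 *\<^sub>R e))"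
    using D by simp
  ultimately have "((\<lambda>t. \<phi> (a + t *\<^sub>R e)) has_derivative (\<lambda>t. D (t *\<^sub>R e))) (at (0 :: real))"
    by (rule has_derivative_compose)
  then have lim: "(\<lambda>h :: real. norm (\<phi> (a + h *\<^sub>R e) - \<phi> a - D (h *\<^sub>R e)) / norm h) \<midarrow>0\<rightarrow> 0"
    by (simp add: has_derivative_at)
  have eq: "norm (\<phi> (a + h *\<^sub>R e) - \<phi> a - D (h *\<^sub>R e)) / norm h
      = norm ((1 / h) *\<^sub>R (\<phi> (a + h *\<^sub>R e) - \<phi> a) - D e)" if "h \<noteq> 0" for h :: real
  proof -
    have "(1 / h) *\<^sub>R (\<phi> (a + h *\<^sub>R e) - \<phi> a) - D e
        = (1 / h) *\<^sub>R (\<phi> (a + h *\<^sub>R e) - \<phi> a - D (h *\<^sub>R e))"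
      using that linear_scale[OF has_derivative_linear[OF D]] by (simp add: scaleR_diff_right)
    then show ?thesis by simp
  qed
  have "(\<lambda>h :: real. norm ((1 / h) *\<^sub>R (\<phi> (a + h *\<^sub>R e) - \<phi> a) - D e)) \<midarrow>0\<rightarrow> 0"
    by (rule Lim_transform_eventually[OF lim]) (auto simp: eventually_at_filter eq[unfolded real_norm_def] intro!: always_eventually)
  then have lim': "(\<lambda>h :: real. (1 / h) *\<^sub>R (\<phi> (a + h *\<^sub>R e) - \<phi> a)) \<midarrow>0\<rightarrow> D e"
    by (rule LIM_zero_cancel[OF tendsto_norm_zero_cancel])
  have "\<forall>\<^sub>F h in at (0 :: real). (1 / h) *\<^sub>R (\<phi> (a + h *\<^sub>R e) - \<phi> a) \<in> E"
    using ev by eventually_elim (intro subspace_scale subspace_diff E)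
  from Lim_in_closed_set[OF E(1) this at_neq_bot lim'] show ?thesis .
qed

lemma is_chart_inj_on: "is_chart c \<Longrightarrow> inj_on (snd c) (fst c)"
  by (metis homeomorphism_apply1 inj_on_inverseI is_chart_def)

lemma chart_inv_chart: "is_chart c \<Longrightarrow> p \<in> fst c \<Longrightarrow> chart_inv c (snd c p) = p"
  by (metis homeomorphism_apply1 is_chart_def)

lemma open_chart_image:
  assumes "is_chart c" "open U"
  shows "open (snd c ` (fst c \<inter> U))"
proof -
  have "openin (top_of_set (snd c ` fst c)) (snd c ` (fst c \<inter> U))"
    using assms unfolding is_chart_def
    by (intro homeomorphism_imp_open_map[of "fst c" _ _ "chart_inv c"]) (auto intro: openin_open_Int)
  then show ?thesis
    using assms(1) unfolding is_chart_def by (meson openin_open_trans)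
qed

lemma continuous_on_chart: "is_chart c \<Longrightarrow> continuous_on (fst c) (snd c)"
  by (simp add: is_chart_def homeomorphism_def)

lemma continuous_on_chart_inv: "is_chart c \<Longrightarrow> continuous_on (snd c ` fst c) (chart_inv c)"
  by (simp add: is_chart_def homeomorphism_def)

lemma C1_manifold_chart: "C1_manifold A \<Longrightarrow> c \<in> A \<Longrightarrow> is_chart c"
  unfolding C1_manifold_def by blast

lemma C1_manifold_finite_basis:
  fixes A :: "('m::{t2_space, second_countable_topology}, 'e::real_normed_vector) chart set"
  assumes "C1_manifold A"
  obtains B :: "'e set" where "finite_basis B"
proof -
  obtain S :: "'e set" where "finite S" "span S = UNIV"
    using assms unfolding C1_manifold_def by blast
  then show ?thesis
    using that by (rule finite_basis_exists)
qed

lemma charts_atD: "c \<in> charts_at A p \<Longrightarrow> c \<in> A" "c \<in> charts_at A p \<Longrightarrow> p \<in> fst c"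
  by (auto simp: charts_at_def)

lemma charts_at_nonempty:
  assumes "C1_manifold A"
  obtains c where "c \<in> charts_at A p"
  using assms unfolding C1_manifold_def charts_at_def by blast

lemma id_C1_maps:
  assumes "C1_manifold A"
  shows "id \<in> C1_maps A A"
  using assms unfolding C1_manifold_def C1_maps_def C1_compatible_def local_rep_def
  by (auto simp: continuous_on_id)

text \<open>
  Restricting charts is what makes it possible to choose constraints with small chart domains;
  the restriction belongs to the atlas because the atlas is maximal.
\<close>

lemma restrict_chart:
  assumes A: "C1_manifold A" and c: "c \<in> A" and U: "open U"
  shows "(fst c \<inter> U, snd c) \<in> A"
proof -
  let ?r = "(fst c \<inter> U, snd c)"
  note ch = C1_manifold_chart[OF A]
  have inv: "chart_inv ?r y = chart_inv c y" if y: "y \<in> snd c ` (fst c \<inter> U)" for y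
  proof -
    obtain q where q: "q \<in> fst c \<inter> U" "y = snd c q" using y by blast
    then have "chart_inv ?r y = q"
      using inj_on_subset[OF is_chart_inj_on[OF ch[OF c]], of "fst c \<inter> U"] by simp
    then show ?thesis using q chart_inv_chart[OF ch[OF c]] by simp
  qed
  have "homeomorphism (fst c \<inter> U) (snd c ` (fst c \<inter> U)) (snd c) (chart_inv c)"
    using ch[OF c] unfolding is_chart_def by (auto intro: homeomorphism_of_subsets)
  then have "homeomorphism (fst c \<inter> U) (snd c ` (fst c \<inter> U)) (snd c) (chart_inv ?r)"
    using inv by (auto intro: homeomorphism_cong)
  moreover have "open (fst c \<inter> U)"
    using ch[OF c] U by (auto simp: is_chart_def)
  ultimately have "is_chart ?r"
    using open_chart_image[OF ch[OF c] U] by (simp add: is_chart_def)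
  moreover have "C1_compatible ?r d" if d: "d \<in> A" for d
  proof -
    have cd: "C1_compatible c d"
      using A c d unfolding C1_manifold_def by blast
    have "open (fst d \<inter> U)"
      using ch[OF d] U by (auto simp: is_chart_def)
    then have op: "open (snd c ` (fst c \<inter> (fst d \<inter> U)))"
      by (rule open_chart_image[OF ch[OF c]])
    have "C1_on (snd c ` (fst c \<inter> (fst d \<inter> U))) (snd d \<circ> chart_inv c)"
      using cd unfolding C1_compatible_def by (auto elim!: C1_on_subset)
    then have "C1_on (snd c ` (fst c \<inter> (fst d \<inter> U))) (snd d \<circ> chart_inv ?r)"
      by (rule C1_on_cong[OF _ op]) (use inv in auto)
    moreover have "C1_on (snd d ` (fst c \<inter> U \<inter> fst d)) (snd c \<circ> chart_inv d)"
      using cd unfolding C1_compatible_def by (auto elim!: C1_on_subset)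
    ultimately show ?thesis
      unfolding C1_compatible_def by (simp add: Int_ac)
  qed
  ultimately show ?thesis
    using A unfolding C1_manifold_def by blast
qed

text \<open>
  The differential of \<open>g\<close> at \<open>p\<close> in the charts \<open>c\<close> and \<open>d\<close>. For \<open>g = id\<close> this is the derivative of the
  transition map, so that changes of charts need no separate treatment.
\<close>

definition local_deriv ::
    "('m, 'e::real_normed_vector) chart \<Rightarrow> ('n, 'f::real_normed_vector) chart \<Rightarrow>
     ('m \<Rightarrow> 'n) \<Rightarrow> 'm \<Rightarrow> 'e \<Rightarrow> 'f" where
  "local_deriv c d g p = frechet_derivative (local_rep c d g) (at (snd c p))"

lemma local_rep_at: "is_chart c \<Longrightarrow> p \<in> fst c \<Longrightarrow> local_rep c d g (snd c p) = snd d (g p)"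
  by (simp add: local_rep_def chart_inv_chart)

lemma local_rep_has_derivative:
  assumes "g \<in> C1_maps A B" "c \<in> charts_at A p" "d \<in> charts_at B (g p)"
  shows "(local_rep c d g has_derivative local_deriv c d g p) (at (snd c p))"
proof -
  have "C1_on (snd c ` (fst c \<inter> g -` fst d)) (local_rep c d g)"
    using assms unfolding C1_maps_def charts_at_def by blast
  then show ?thesis
    unfolding local_deriv_def using assms by (intro C1_on_has_derivative) (auto simp: charts_at_def)
qed

lemma linear_local_deriv:
  assumes "g \<in> C1_maps A B" "c \<in> charts_at A p" "d \<in> charts_at B (g p)"
  shows "linear (local_deriv c d g p)"
  using has_derivative_linear[OF local_rep_has_derivative[OF assms]] .

lemma open_local_domain:
  assumes "C1_manifold A" "C1_manifold B" "g \<in> C1_maps A B" "c \<in> A" "d \<in> B"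
  shows "open (snd c ` (fst c \<inter> g -` fst d))"
proof (rule open_chart_image)
  show "is_chart c" using C1_manifold_chart assms by blast
  have "open (fst d)" using C1_manifold_chart assms is_chart_def by blast
  then show "open (g -` fst d)"
    using assms(3) by (auto simp: C1_maps_def intro: open_vimage)
qed

lemma local_deriv_chain:
  assumes L: "C1_manifold L" and A: "C1_manifold A"
    and g: "g \<in> C1_maps L A" and h: "h \<in> C1_maps A B"
    and c: "c \<in> charts_at L p" and d: "d \<in> charts_at A (g p)" and e: "e \<in> charts_at B (h (g p))"
  shows "local_deriv c e (h \<circ> g) p = local_deriv d e h (g p) \<circ> local_deriv c d g p"
proof -
  note chc = C1_manifold_chart[OF L charts_atD(1)[OF c]] and chd = C1_manifold_chart[OF A charts_atD(1)[OF d]]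
  let ?W = "snd c ` (fst c \<inter> g -` fst d)"
  have "(local_rep d e h \<circ> local_rep c d g has_derivative local_deriv d e h (g p) \<circ> local_deriv c d g p)
      (at (snd c p))"
    using local_rep_has_derivative[OF g c d] local_rep_has_derivative[OF h d e]
    by (intro diff_chain_at) (simp_all add: local_rep_at[OF chc charts_atD(2)[OF c]])
  then have "(local_rep c e (h \<circ> g) has_derivative local_deriv d e h (g p) \<circ> local_deriv c d g p) (at (snd c p))"
  proof (rule has_derivative_transform_within_open)
    show "open ?W"
      using open_local_domain[OF L A g] c d by (auto simp: charts_at_def)
    show "snd c p \<in> ?W"
      using c d by (auto simp: charts_at_def)
    show "(local_rep d e h \<circ> local_rep c d g) x = local_rep c e (h \<circ> g) x" if "x \<in> ?W" for x
      using that by (auto simp: local_rep_at[OF chc] local_rep_at[OF chd])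
  qed
  then show ?thesis
    by (subst local_deriv_def) (rule frechet_derivative_at[symmetric])
qed

lemma local_deriv_id:
  assumes A: "C1_manifold A" and c: "c \<in> charts_at A p"
  shows "local_deriv c c id p = id"
proof -
  note ch = C1_manifold_chart[OF A charts_atD(1)[OF c]]
  have "(local_rep c c id has_derivative id) (at (snd c p))"
  proof (rule has_derivative_transform_within_open[of id])
    show "open (snd c ` fst c)" using ch by (simp add: is_chart_def)
    show "id x = local_rep c c id x" if "x \<in> snd c ` fst c" for x
      using that by (auto simp: local_rep_at[OF ch])
  qed (use c in \<open>auto simp: charts_at_def\<close>)
  then show ?thesis
    by (subst local_deriv_def) (rule frechet_derivative_at[symmetric])
qed

lemma local_deriv_id_chain:
  assumes "C1_manifold A" "c \<in> charts_at A p" "d \<in> charts_at A p" "e \<in> charts_at A p"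
  shows "local_deriv d e id p (local_deriv c d id p v) = local_deriv c e id p v"
  using local_deriv_chain[OF assms(1,1) id_C1_maps[OF assms(1)] id_C1_maps[OF assms(1)], of c p d e] assms
  by (simp add: fun_eq_iff)

section \<open>Tangent vectors and transversality in charts\<close>

lemma tangent_space_iff:
  "v \<in> tangent_space A p \<longleftrightarrow>
     (\<forall>c\<in>charts_at A p. \<forall>d\<in>charts_at A p. v d = local_deriv c d id p (v c)) \<and>
     (\<forall>c. c \<notin> charts_at A p \<longrightarrow> v c = 0)"
  by (simp add: tangent_space_def local_deriv_def local_rep_def)

lemma tangent_spaceI:
  assumes "\<And>c d. c \<in> charts_at A p \<Longrightarrow> d \<in> charts_at A p \<Longrightarrow> v d = local_deriv c d id p (v c)"
    and "\<And>c. c \<notin> charts_at A p \<Longrightarrow> v c = 0"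
  shows "v \<in> tangent_space A p"
  using assms unfolding tangent_space_iff by blast

lemma tangent_vector_change_chart:
  "v \<in> tangent_space A p \<Longrightarrow> c \<in> charts_at A p \<Longrightarrow> d \<in> charts_at A p \<Longrightarrow>
    v d = local_deriv c d id p (v c)"
  unfolding tangent_space_iff by blast

lemma tangent_vector_eqI:
  assumes "v \<in> tangent_space A p" "w \<in> tangent_space A p" "c \<in> charts_at A p" "v c = w c"
  shows "v = w"
  using assms unfolding tangent_space_iff by (metis ext)

text \<open>
  By the chain rule for transition maps, a coordinate vector in one chart extends to a compatible
  family.
\<close>

lemma tangent_vector_exists:
  assumes "C1_manifold A" "c \<in> charts_at A p"
  obtains v where "v \<in> tangent_space A p" "v c = e"
proof -
  define v where "v d = (if d \<in> charts_at A p then local_deriv c d id p e else 0)" for d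
  have "v \<in> tangent_space A p"
    unfolding tangent_space_iff v_def using assms by (auto simp: local_deriv_id_chain)
  moreover have "v c = e"
    using assms by (simp add: v_def local_deriv_id)
  ultimately show ?thesis using that by blast
qed

lemma tangent_space_linear_combination:
  assumes A: "C1_manifold A" and "v \<in> tangent_space A p" "w \<in> tangent_space A p"
  shows "(\<lambda>c. a *\<^sub>R v c + b *\<^sub>R w c) \<in> tangent_space A p"
proof (rule tangent_spaceI)
  fix c d assume cd: "c \<in> charts_at A p" "d \<in> charts_at A p"
  have "linear (local_deriv c d id p)"
    using linear_local_deriv[OF id_C1_maps[OF A]] cd by simp
  then show "a *\<^sub>R v d + b *\<^sub>R w d = local_deriv c d id p (a *\<^sub>R v c + b *\<^sub>R w c)"
    using tangent_vector_change_chart[OF assms(2) cd] tangent_vector_change_chart[OF assms(3) cd]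
    by (simp add: linear_add linear_scale)
next
  fix c assume "c \<notin> charts_at A p"
  then show "a *\<^sub>R v c + b *\<^sub>R w c = 0"
    using assms(2,3) unfolding tangent_space_iff by (metis scaleR_zero_right add_0)
qed

text \<open>
  The chain rule removes the arbitrary choice of a chart in the definition of the differential.
\<close>

lemma differential_in_chart:
  assumes "C1_manifold L" "g \<in> C1_maps L A"
    and "v \<in> tangent_space L p" "c \<in> charts_at L p" "d \<in> charts_at A (g p)"
  shows "differential L A g p v d = local_deriv c d g p (v c)"
proof -
  define c' where "c' = (SOME c. c \<in> charts_at L p)"
  have c': "c' \<in> charts_at L p"
    unfolding c'_def using assms(4) by (rule someI)
  have "differential L A g p v d = local_deriv c' d g p (v c')"
    using assms(5) by (simp add: differential_def local_deriv_def c'_def Let_def)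
  also have "v c' = local_deriv c c' id p (v c)"
    using assms(3,4) c' by (rule tangent_vector_change_chart)
  also have "local_deriv c' d g p (local_deriv c c' id p (v c)) = local_deriv c d g p (v c)"
    using local_deriv_chain[OF assms(1,1) id_C1_maps[OF assms(1)] assms(2), of c p c' d] assms(4,5) c'
    by (simp add: fun_eq_iff)
  finally show ?thesis .
qed

lemma differential_in_tangent_space:
  assumes "C1_manifold L" "C1_manifold A" "g \<in> C1_maps L A" "v \<in> tangent_space L p"
  shows "differential L A g p v \<in> tangent_space A (g p)"
proof -
  obtain c where c: "c \<in> charts_at L p"
    using charts_at_nonempty[OF assms(1)] by metis
  have "differential L A g p v e = local_deriv d e id (g p) (differential L A g p v d)"
    if "d \<in> charts_at A (g p)" "e \<in> charts_at A (g p)" for d e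
    using local_deriv_chain[OF assms(1-3) id_C1_maps[OF assms(2)] c that(1), of e] that c assms
    by (simp add: differential_in_chart fun_eq_iff)
  then show ?thesis
    by (rule tangent_spaceI) (simp_all add: differential_def)
qed

text \<open>
  Transversality in coordinates: the image of \<open>T\<close> and the set \<open>E\<close> together span the space.
\<close>

definition chart_transverse :: "('d::real_normed_vector \<Rightarrow> 'e::real_normed_vector) \<Rightarrow> 'e set \<Rightarrow> bool" where
  "chart_transverse T E \<longleftrightarrow> (\<forall>e. \<exists>v. \<exists>u\<in>E. e = T v + u)"

text \<open>
  Evaluating tangent vectors in a chart is a linear bijection onto the model space, so the sum of
  tangent spaces may be computed there.
\<close>

lemma transverse_in_charts:
  assumes L: "C1_manifold L" and A: "C1_manifold A" and g: "g \<in> C1_maps L A"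
    and c: "c \<in> charts_at L w" and d: "d \<in> charts_at A (g w)" and E: "E \<subseteq> tangent_space A (g w)"
  shows "tvec_sum (differential L A g w ` tangent_space L w) E = tangent_space A (g w) \<longleftrightarrow>
    chart_transverse (local_deriv c d g w) (coord d E)"
proof
  assume eq: "tvec_sum (differential L A g w ` tangent_space L w) E = tangent_space A (g w)"
  show "chart_transverse (local_deriv c d g w) (coord d E)"
    unfolding chart_transverse_def
  proof
    fix e
    obtain z where z: "z \<in> tangent_space A (g w)" "z d = e"
      using tangent_vector_exists[OF A d] by metis
    then obtain v u where "v \<in> tangent_space L w" "u \<in> E" "z = (\<lambda>c. differential L A g w v c + u c)"
      unfolding eq[symmetric] tvec_sum_def by blast
    then have "e = local_deriv c d g w (v c) + u d" "u d \<in> coord d E"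
      using z(2) differential_in_chart[OF L g _ c d] by (auto simp: coord_def)
    then show "\<exists>v. \<exists>u\<in>coord d E. e = local_deriv c d g w v + u" by blast
  qed
next
  assume tr: "chart_transverse (local_deriv c d g w) (coord d E)"
  show "tvec_sum (differential L A g w ` tangent_space L w) E = tangent_space A (g w)"
  proof
    show "tvec_sum (differential L A g w ` tangent_space L w) E \<subseteq> tangent_space A (g w)"
      using tangent_space_linear_combination[OF A, of _ "g w" _ 1 1]
        differential_in_tangent_space[OF L A g] E by (auto simp: tvec_sum_def subset_iff)
    show "tangent_space A (g w) \<subseteq> tvec_sum (differential L A g w ` tangent_space L w) E"
    proof
      fix z assume z: "z \<in> tangent_space A (g w)"
      obtain e u where e: "u \<in> E" "z d = local_deriv c d g w e + u d"
        using tr unfolding chart_transverse_def coord_def by blast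
      obtain v where v: "v \<in> tangent_space L w" "v c = e"
        using tangent_vector_exists[OF L c] by metis
      let ?s = "\<lambda>c. differential L A g w v c + u c"
      have "?s \<in> tangent_space A (g w)"
        using tangent_space_linear_combination[OF A, of _ "g w" _ 1 1]
          differential_in_tangent_space[OF L A g v(1)] e(1) E by auto
      then have "z = ?s"
        using z d e(2) v differential_in_chart[OF L g v(1) c d] by (intro tangent_vector_eqI) auto
      then show "z \<in> tvec_sum (differential L A g w ` tangent_space L w) E"
        unfolding tvec_sum_def using v(1) e(1) by blast
    qed
  qed
qed

section \<open>Tangent spaces of submanifolds and leaves\<close>

text \<open>
  In the direction \<open>e \<in> E\<close> the transition map sends a short segment of the slice \<open>E\<close>, which consists of
  points of \<open>S\<close>, into the slice \<open>F\<close>; so its derivative in this direction lies in \<open>F\<close>.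
\<close>

lemma slice_chart_transition:
  assumes A: "C1_manifold A" and p: "p \<in> S"
    and c: "slice_chart A S p c E" and d: "slice_chart A S p d F" and e: "e \<in> E"
  shows "local_deriv c d id p e \<in> F"
proof -
  have cp: "c \<in> charts_at A p" and dp: "d \<in> charts_at A p"
    and E: "subspace E" "snd c ` (S \<inter> fst c) = E \<inter> snd c ` fst c"
    and F: "subspace F" "snd d ` (S \<inter> fst d) = F \<inter> snd d ` fst d"
    using c d by (auto simp: slice_chart_def)
  note chc = C1_manifold_chart[OF A charts_atD(1)[OF cp]]
  obtain B :: "'b set" where "finite_basis B"
    using C1_manifold_finite_basis[OF A] by blast
  then interpret finite_basis B .
  have pc: "snd c p \<in> E" and pd: "snd d p \<in> F"
    using E(2) F(2) p charts_atD(2)[OF cp] charts_atD(2)[OF dp] by blast+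
  let ?W = "snd c ` (fst c \<inter> fst d)"
  have W: "open ?W" "snd c p \<in> ?W"
    using open_local_domain[OF A A id_C1_maps[OF A], of c d] cp dp by (auto simp: charts_at_def)
  have in_F: "local_rep c d id x \<in> F" if x: "x \<in> E" "x \<in> ?W" for x
  proof -
    obtain q where q: "q \<in> fst c" "q \<in> fst d" "x = snd c q" using x(2) by blast
    then have "x \<in> snd c ` (S \<inter> fst c)" using E(2) x(1) by blast
    then have "q \<in> S" using q is_chart_inj_on[OF chc] by (auto dest: inj_onD)
    then show ?thesis using F(2) q by (auto simp: local_rep_at[OF chc])
  qed
  have "((\<lambda>t. snd c p + t *\<^sub>R e) \<longlongrightarrow> snd c p + 0 *\<^sub>R e) (at (0 :: real))"
    by (intro tendsto_intros)
  then have "\<forall>\<^sub>F t in at (0 :: real). snd c p + t *\<^sub>R e \<in> ?W"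
    using topological_tendstoD[OF _ W(1)] W(2) by simp
  then have ev: "\<forall>\<^sub>F t in at (0 :: real). local_rep c d id (snd c p + t *\<^sub>R e) \<in> F"
  proof eventually_elim
    case (elim t)
    then show ?case
      using E(1) pc e by (intro in_F) (auto intro: subspace_add subspace_scale)
  qed
  have p_in_F: "local_rep c d id (snd c p) \<in> F"
    using pd by (simp add: local_rep_at[OF chc charts_atD(2)[OF cp]])
  have D: "(local_rep c d id has_derivative local_deriv c d id p) (at (snd c p))"
    using local_rep_has_derivative[OF id_C1_maps[OF A] cp, of d] dp by simp
  show ?thesis
    by (rule derivative_in_closed_subspace[OF D closed_subspace[OF F(1)] F(1) p_in_F ev])
qed

text \<open>
  The definition allows a different slice chart for each vector; one slice chart suffices for all of
  them. This is what makes the tangent space of a submanifold closed under addition.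
\<close>

lemma sub_tangent_space_in_slice_chart:
  assumes A: "C1_manifold A" and p: "p \<in> S" and c: "slice_chart A S p c E"
  shows "v \<in> sub_tangent_space A S p \<longleftrightarrow> v \<in> tangent_space A p \<and> v c \<in> E"
proof
  assume "v \<in> sub_tangent_space A S p"
  then obtain d F where v: "v \<in> tangent_space A p" and d: "slice_chart A S p d F" "v d \<in> F"
    by (auto simp: sub_tangent_space_def)
  moreover have "v c = local_deriv d c id p (v d)"
    using tangent_vector_change_chart[OF v] c d(1) by (simp add: slice_chart_def)
  ultimately show "v \<in> tangent_space A p \<and> v c \<in> E"
    using slice_chart_transition[OF A p d(1) c d(2)] by simp
next
  assume "v \<in> tangent_space A p \<and> v c \<in> E"
  with c show "v \<in> sub_tangent_space A S p"
    unfolding sub_tangent_space_def by blast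
qed

lemma subspace_coord_leaf_tangent:
  assumes A: "C1_manifold A" and S: "embedded_submanifold A S" "x \<in> S" and f: "f \<in> C1_maps A P"
    and d: "d \<in> charts_at A x"
  shows "subspace (coord d (leaf_tangent A P f S x))"
proof -
  obtain c E where c: "slice_chart A S x c E"
    using S unfolding embedded_submanifold_def by metis
  then have E: "subspace E" and cx: "c \<in> charts_at A x" by (auto simp: slice_chart_def)
  note sub = sub_tangent_space_in_slice_chart[OF A S(2) c]
  have comb: "(\<lambda>c. a *\<^sub>R v c + b *\<^sub>R w c) \<in> leaf_tangent A P f S x"
    if v: "v \<in> leaf_tangent A P f S x" and w: "w \<in> leaf_tangent A P f S x" for v w a b
  proof -
    let ?z = "\<lambda>c. a *\<^sub>R v c + b *\<^sub>R w c"
    have vT: "v \<in> tangent_space A x" "v c \<in> E" and wT: "w \<in> tangent_space A x" "w c \<in> E"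
      and v0: "differential A P f x v = (\<lambda>d. 0)" and w0: "differential A P f x w = (\<lambda>d. 0)"
      using v w by (auto simp: leaf_tangent_def sub)
    have zT: "?z \<in> tangent_space A x"
      using tangent_space_linear_combination[OF A vT(1) wT(1)] .
    have "differential A P f x ?z e = 0" for e
    proof (cases "e \<in> charts_at P (f x)")
      case True
      have "local_deriv c e f x (v c) = 0" "local_deriv c e f x (w c) = 0"
        using v0 w0 differential_in_chart[OF A f vT(1) cx True] differential_in_chart[OF A f wT(1) cx True]
        by simp_all
      then show ?thesis
        using linear_local_deriv[OF f cx True]
        by (simp add: differential_in_chart[OF A f zT cx True] linear_add linear_scale)
    qed (simp add: differential_def)
    then show ?thesis
      using zT vT(2) wT(2) E by (auto simp: leaf_tangent_def sub subspace_add subspace_scale)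
  qed
  have "(\<lambda>c. 0) \<in> leaf_tangent A P f S x"
  proof -
    have "(\<lambda>c. 0) \<in> tangent_space A x"
    proof -
      obtain v where "v \<in> tangent_space A x"
        using tangent_vector_exists[OF A d] by metis
      from tangent_space_linear_combination[OF A this this, of 0 0] show ?thesis by simp
    qed
    moreover have "differential A P f x (\<lambda>c. 0) e = 0" for e
      using differential_in_chart[OF A f calculation cx, of e] linear_0[OF linear_local_deriv[OF f cx, of e]]
      by (cases "e \<in> charts_at P (f x)") (auto simp: differential_def)
    ultimately show ?thesis
      using subspace_0[OF E] by (auto simp: leaf_tangent_def sub)
  qed
  then have zero: "0 \<in> coord d (leaf_tangent A P f S x)"
    unfolding coord_def by (rule rev_image_eqI) simp
  show ?thesis
  proof (rule subspaceI[OF zero])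
    fix y z assume "y \<in> coord d (leaf_tangent A P f S x)" "z \<in> coord d (leaf_tangent A P f S x)"
    then show "y + z \<in> coord d (leaf_tangent A P f S x)"
      using comb[of _ _ 1 1] by (force simp: coord_def)
  next
    fix a y assume "y \<in> coord d (leaf_tangent A P f S x)"
    then show "a *\<^sub>R y \<in> coord d (leaf_tangent A P f S x)"
      using comb[of _ _ a 0] by (force simp: coord_def)
  qed
qed

section \<open>Semicontinuity of transversality to the leaves\<close>

text \<open>
  Write each basis vector \<open>e\<close> as \<open>T\<^sub>0 v + (\<Sum>i<k. a\<^sub>i b\<^sub>i)\<close>. With \<open>v\<close> and \<open>a\<close> fixed,
  \<open>T\<^sub>n v + (\<Sum>i<k. a\<^sub>i \<beta>\<^sub>n i)\<close> converges to \<open>e\<close>, and a family of vectors close to a basis spans.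
\<close>

lemma chart_transverse_limit:
  fixes T :: "nat \<Rightarrow> 'd::real_normed_vector \<Rightarrow> 'e::real_normed_vector"
  assumes B: "finite_basis (B :: 'e set)"
    and b: "b \<in> frames k" and \<beta>: "\<And>i. i < k \<Longrightarrow> (\<lambda>n. \<beta> n i) \<longlonglongrightarrow> b i"
    and lin: "\<And>n. linear (T n)" and T: "\<And>v. (\<lambda>n. T n v) \<longlonglongrightarrow> T\<^sub>0 v"
    and tr: "chart_transverse T\<^sub>0 (span (b ` {..<k}))"
  shows "\<forall>\<^sub>F n in sequentially. chart_transverse (T n) (span (\<beta> n ` {..<k}))"
proof -
  interpret finite_basis B by (rule B)
  have "\<exists>v a. e = T\<^sub>0 v + (\<Sum>i<k. a i *\<^sub>R b i)" for e
  proof -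
    obtain v u where u: "u \<in> span (b ` {..<k})" "e = T\<^sub>0 v + u"
      using tr unfolding chart_transverse_def by blast
    from u(1) obtain c where "u = (\<Sum>x\<in>b ` {..<k}. c x *\<^sub>R x)"
      by (auto simp: span_finite)
    also have "\<dots> = (\<Sum>i<k. c (b i) *\<^sub>R b i)"
      using b by (subst sum.reindex) (auto simp: frames_def)
    finally have "e = T\<^sub>0 v + (\<Sum>i<k. c (b i) *\<^sub>R b i)"
      using u(2) by simp
    then show ?thesis
      by (intro exI[of _ v] exI[of _ "\<lambda>i. c (b i)"])
  qed
  then obtain v a where va: "\<And>e. e = T\<^sub>0 (v e) + (\<Sum>i<k. a e i *\<^sub>R b i)"
    by metis
  define u where "u n e = T n (v e) + (\<Sum>i<k. a e i *\<^sub>R \<beta> n i)" for n e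
  have u_lim: "(\<lambda>n. u n e) \<longlonglongrightarrow> e" for e
  proof -
    have "(\<lambda>n. u n e) \<longlonglongrightarrow> T\<^sub>0 (v e) + (\<Sum>i<k. a e i *\<^sub>R b i)"
      unfolding u_def by (intro tendsto_intros T \<beta>) auto
    then show ?thesis using va[of e] by simp
  qed
  obtain \<delta> where \<delta>: "\<delta> > 0" "\<And>u. (\<forall>b\<in>B. norm (u b - b) \<le> \<delta>) \<Longrightarrow> span (u ` B) = UNIV"
    using spanning_perturbation by metis
  have "\<forall>\<^sub>F n in sequentially. norm (u n e - e) \<le> \<delta>" for e
    using tendstoD[OF u_lim \<delta>(1), of e] by eventually_elim (simp add: dist_norm)
  then have "\<forall>\<^sub>F n in sequentially. \<forall>e\<in>B. norm (u n e - e) \<le> \<delta>"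
    by (simp add: eventually_ball_finite finite_B)
  then show ?thesis
  proof eventually_elim
    case (elim n)
    let ?S = "{T n x + w | x w. w \<in> span (\<beta> n ` {..<k})}"
    have "subspace ?S"
    proof -
      have "subspace (range (T n))"
        using lin by (simp add: linear_subspace_image)
      then have "subspace {x + y | x y. x \<in> range (T n) \<and> y \<in> span (\<beta> n ` {..<k})}"
        by (intro subspace_sums subspace_span)
      moreover have "{x + y | x y. x \<in> range (T n) \<and> y \<in> span (\<beta> n ` {..<k})} = ?S"
        by blast
      ultimately show ?thesis by simp
    qed
    moreover have "u n e \<in> ?S" for e
    proof -
      have "(\<Sum>i<k. a e i *\<^sub>R \<beta> n i) \<in> span (\<beta> n ` {..<k})"
        by (intro span_sum span_scale span_base) simp
      then show ?thesis unfolding u_def by blast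
    qed
    ultimately have "span (u n ` B) \<subseteq> ?S"
      by (intro span_minimal) auto
    then have "?S = UNIV"
      using \<delta>(2)[OF elim] by blast
    then show ?case
      unfolding chart_transverse_def by blast
  qed
qed

text \<open>
  This is where \<open>(a\<^sub>f)\<close>-regularity enters; the argument by contradiction is the one sketched at
  the beginning.
\<close>

lemma transversality_semicontinuous:
  fixes N :: "('n::{t2_space, second_countable_topology}, 'e::real_normed_vector) chart set"
    and P :: "('p::{t2_space, second_countable_topology}, 'f::real_normed_vector) chart set"
    and T\<^sub>0 :: "'d::real_normed_vector \<Rightarrow> 'e"
  assumes N: "C1_manifold N" and V: "closed V" and \<Sigma>: "prestratification N V \<Sigma>"
    and f: "f \<in> C1_maps N P" and af: "af_regular N P f \<Sigma>"
    and d: "d \<in> charts_at N y"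
    and tr: "\<And>Y. Y \<in> \<Sigma> \<Longrightarrow> y \<in> Y \<Longrightarrow> chart_transverse T\<^sub>0 (coord d (leaf_tangent N P f Y y))"
  shows "\<exists>W \<epsilon>. open W \<and> y \<in> W \<and> W \<subseteq> fst d \<and> \<epsilon> > 0 \<and>
    (\<forall>x\<in>W. \<forall>T. linear T \<longrightarrow> (\<forall>v. norm (T v - T\<^sub>0 v) \<le> \<epsilon> * norm v) \<longrightarrow>
      (\<forall>X\<in>\<Sigma>. x \<in> X \<longrightarrow> chart_transverse T (coord d (leaf_tangent N P f X x))))"
proof (rule ccontr)
  assume contra: "\<not> ?thesis"
  obtain B :: "'e set" where B: "finite_basis B"
    using C1_manifold_finite_basis[OF N] by blast
  then interpret finite_basis B .
  let ?L = "\<lambda>X x. coord d (leaf_tangent N P f X x)"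
  have \<Sigma>_sub: "embedded_submanifold N S" if "S \<in> \<Sigma>" for S
    using \<Sigma> that by (auto simp: prestratification_def)
  have "open (fst d)"
    using C1_manifold_chart[OF N charts_atD(1)[OF d]] by (simp add: is_chart_def)
  obtain U :: "nat \<Rightarrow> 'n set" where U: "\<And>i. open (U i)" "\<And>i. y \<in> U i"
    "\<And>S. open S \<Longrightarrow> y \<in> S \<Longrightarrow> \<forall>\<^sub>F i in sequentially. U i \<subseteq> S"
    using countable_basis_at_decseq by blast
  \<comment> \<open>a counterexample to the claim in the \<open>n\<close>-th neighbourhood with \<open>\<epsilon> = 1 / (n + 1)\<close>\<close>
  define bad_at where "bad_at n x T X \<longleftrightarrow> x \<in> U n \<inter> fst d \<and> linear T \<and>
      (\<forall>v. norm (T v - T\<^sub>0 v) \<le> 1 / real (Suc n) * norm v) \<and>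
      X \<in> \<Sigma> \<and> x \<in> X \<and> \<not> chart_transverse T (?L X x)" for n x T X
  have "\<exists>x T X. bad_at n x T X" for n
  proof (rule ccontr)
    assume "\<not> ?thesis"
    then have "\<forall>x\<in>U n \<inter> fst d. \<forall>T. linear T \<longrightarrow> (\<forall>v. norm (T v - T\<^sub>0 v) \<le> 1 / real (Suc n) * norm v) \<longrightarrow>
      (\<forall>X\<in>\<Sigma>. x \<in> X \<longrightarrow> chart_transverse T (?L X x))"
      unfolding bad_at_def by blast
    moreover have "open (U n \<inter> fst d)" "y \<in> U n \<inter> fst d" "U n \<inter> fst d \<subseteq> fst d" "1 / real (Suc n) > 0"
      using U(1,2) \<open>open (fst d)\<close> charts_atD(2)[OF d] by auto
    ultimately show False using contra by blast
  qed
  then obtain x T X where bad: "\<And>n. bad_at n (x n) (T n) (X n)"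
    by metis
  then have x: "\<And>n. x n \<in> U n \<inter> fst d" and T: "\<And>n. linear (T n)"
    "\<And>n v. norm (T n v - T\<^sub>0 v) \<le> 1 / real (Suc n) * norm v"
    and X: "\<And>n. X n \<in> \<Sigma>" "\<And>n. x n \<in> X n" and bad: "\<And>n. \<not> chart_transverse (T n) (?L (X n) (x n))"
    unfolding bad_at_def by simp_all
  have x_lim: "x \<longlonglongrightarrow> y"
  proof (rule topological_tendstoI)
    fix S assume "open S" "y \<in> S"
    then have "\<forall>\<^sub>F i in sequentially. U i \<subseteq> S" by (rule U(3))
    then show "\<forall>\<^sub>F i in sequentially. x i \<in> S"
      by eventually_elim (use x in blast)
  qed
  have T_lim: "(\<lambda>n. T n v) \<longlonglongrightarrow> T\<^sub>0 v" for v
  proof (rule LIM_zero_cancel[OF tendsto_norm_zero_cancel])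
    have "(\<lambda>n. 1 / real (Suc n) * norm v) \<longlonglongrightarrow> 0 * norm v"
      using LIMSEQ_inverse_real_of_nat by (intro tendsto_intros) (simp add: inverse_eq_divide)
    then have "(\<lambda>n. 1 / real (Suc n) * norm v) \<longlonglongrightarrow> 0" by simp
    then show "(\<lambda>n. norm (T n v - T\<^sub>0 v)) \<longlonglongrightarrow> 0"
      by (rule tendsto_sandwich[OF _ _ tendsto_const, rotated 2])
        (simp_all only: T(2) norm_ge_zero eventually_True)
  qed
  have "\<Union>\<Sigma> = V" using \<Sigma> by (simp add: prestratification_def)
  then have "x n \<in> V" for n using X by blast
  then have "y \<in> V"
    using closed_sequentially[OF V] x_lim by blast
  then obtain Y where Y: "Y \<in> \<Sigma>" "y \<in> Y" using \<open>\<Union>\<Sigma> = V\<close> by blast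
  obtain W where W: "open W" "y \<in> W" "finite {S \<in> \<Sigma>. S \<inter> W \<noteq> {}}"
    using \<Sigma> \<open>y \<in> V\<close> unfolding prestratification_def by blast
  obtain n0 where n0: "\<And>n. n \<ge> n0 \<Longrightarrow> x n \<in> W"
    using topological_tendstoD[OF x_lim W(1,2)] by (auto simp: eventually_sequentially)
  \<comment> \<open>close to \<open>y\<close>, both the stratum and the dimension of the leaf take only finitely many values\<close>
  define \<kappa> where "\<kappa> n = (X (n + n0), dim (?L (X (n + n0)) (x (n + n0))))" for n
  have "range \<kappa> \<subseteq> {S \<in> \<Sigma>. S \<inter> W \<noteq> {}} \<times> {..fd.dimension}"
  proof (intro image_subsetI)
    fix n
    have "x (n + n0) \<in> X (n + n0) \<inter> W"
      using X(2) n0 by simp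
    then show "\<kappa> n \<in> {S \<in> \<Sigma>. S \<inter> W \<noteq> {}} \<times> {..fd.dimension}"
      using X(1) fd.dim_subset_UNIV by (auto simp: \<kappa>_def)
  qed
  then have "finite (range \<kappa>)"
    by (rule finite_subset) (intro finite_cartesian_product W(3) finite_atMost)
  then obtain m where "infinite {n. \<kappa> n = \<kappa> m}"
    using pigeonhole_infinite[of UNIV \<kappa>] by auto
  then obtain r1 where r1: "strict_mono (r1 :: nat \<Rightarrow> nat)" "\<And>n. \<kappa> (r1 n) = \<kappa> m"
    using infinite_enumerate[of "{n. \<kappa> n = \<kappa> m}"] by blast
  define X0 where "X0 = fst (\<kappa> m)"
  define k where "k = snd (\<kappa> m)"
  define s where "s n = r1 n + n0" for n
  have s: "X (s n) = X0" "dim (?L X0 (x (s n))) = k" for n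
  proof -
    have "(X (s n), dim (?L (X (s n)) (x (s n)))) = \<kappa> (r1 n)"
      by (simp add: \<kappa>_def s_def)
    also have "\<dots> = (X0, k)"
      by (simp add: r1(2) X0_def k_def)
    finally show "X (s n) = X0" "dim (?L X0 (x (s n))) = k"
      by auto
  qed
  have X0: "X0 \<in> \<Sigma>" "x (s n) \<in> X0" for n
    using X[of "s n"] s(1)[of n] by auto
  have sub: "subspace (?L X0 (x (s n)))" for n
  proof (rule subspace_coord_leaf_tangent[OF N \<Sigma>_sub[OF X0(1)] X0(2) f])
    show "d \<in> charts_at N (x (s n))"
      using x[of "s n"] d by (simp add: charts_at_def)
  qed
  from grassmannian_seq_compact[of "\<lambda>n. ?L X0 (x (s n))", OF sub s(2)]
  obtain r2 \<beta> b where gr: "strict_mono (r2 :: nat \<Rightarrow> nat) \<and>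
    (\<forall>n. \<beta> n \<in> frames k \<and> span (\<beta> n ` {..<k}) = ?L X0 (x (s (r2 n)))) \<and>
    b \<in> frames k \<and> (\<forall>i<k. (\<lambda>n. \<beta> n i) \<longlonglongrightarrow> b i)"
    by (elim exE) (rule that)
  then have r2: "strict_mono r2" and \<beta>: "\<And>n. \<beta> n \<in> frames k"
    "\<And>n. span (\<beta> n ` {..<k}) = ?L X0 (x (s (r2 n)))"
    and b: "b \<in> frames k" "\<And>i. i < k \<Longrightarrow> (\<lambda>n. \<beta> n i) \<longlonglongrightarrow> b i"
    by auto
  define q where "q n = s (r2 n)" for n
  have q: "strict_mono q"
    using r1(1) r2 by (auto simp: strict_mono_def q_def s_def)
  define \<tau> where "\<tau> = {v \<in> tangent_space N y. v d \<in> span (b ` {..<k})}"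
  have coord_\<tau>: "coord d \<tau> = span (b ` {..<k})"
  proof
    show "coord d \<tau> \<subseteq> span (b ` {..<k})" by (auto simp: coord_def \<tau>_def)
    show "span (b ` {..<k}) \<subseteq> coord d \<tau>"
    proof
      fix e assume e: "e \<in> span (b ` {..<k})"
      obtain v where "v \<in> tangent_space N y" "v d = e"
        using tangent_vector_exists[OF N d] by metis
      then show "e \<in> coord d \<tau>" using e by (auto simp: coord_def \<tau>_def)
    qed
  qed
  have "limitin (grassmannian k) (\<lambda>n. ?L X0 (x (q n))) (coord d \<tau>) sequentially"
    using limitin_grassmannian[OF \<beta>(1) b] by (simp add: \<beta>(2) q_def coord_\<tau>)
  moreover have xq: "(\<lambda>n. x (q n)) \<longlonglongrightarrow> y"
    using LIMSEQ_subseq_LIMSEQ[OF x_lim q] by (simp add: o_def)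
  ultimately have "grassmann_converges N (\<lambda>n. x (q n)) (\<lambda>n. leaf_tangent N P f X0 (x (q n))) y \<tau>"
    unfolding grassmann_converges_def using d by (auto simp: \<tau>_def)
  moreover have "af_regular_at N P f X0 Y y"
  proof -
    have "y \<in> closure X0"
      using xq X0(2) unfolding closure_sequential q_def by (intro exI[of _ "\<lambda>n. x (s (r2 n))"]) simp
    then show ?thesis
      using af X0(1) Y unfolding af_regular_def af_regular_pair_def af_regular_over_def by blast
  qed
  moreover have "\<forall>n. x (q n) \<in> X0"
    using X0(2) by (simp add: q_def)
  ultimately have "leaf_tangent N P f Y y \<subseteq> \<tau>"
    unfolding af_regular_at_def by (elim allE[of _ "\<lambda>n. x (q n)"] allE[of _ \<tau>] impE) simp_all
  then have "?L Y y \<subseteq> span (b ` {..<k})"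
    unfolding coord_\<tau>[symmetric] by (auto simp: coord_def)
  then have "chart_transverse T\<^sub>0 (span (b ` {..<k}))"
    using tr[OF Y] unfolding chart_transverse_def by blast
  then have "\<forall>\<^sub>F n in sequentially. chart_transverse (T (q n)) (span (\<beta> n ` {..<k}))"
    using LIMSEQ_subseq_LIMSEQ[OF T_lim q]
    by (intro chart_transverse_limit[OF B b T(1)]) (simp_all add: o_def)
  then obtain n where "chart_transverse (T (q n)) (?L X0 (x (q n)))"
    unfolding \<beta>(2) q_def[symmetric] by (auto simp: eventually_sequentially)
  then show False
    using bad[of "q n"] s(1)[of "r2 n"] by (simp add: q_def)
qed

section \<open>Constraints that force transversality\<close>

lemma compact_coordinate_ball:
  assumes A: "C1_manifold A" and c: "c \<in> charts_at A p"
    and \<delta>: "\<delta> > 0" "cball (snd c p) \<delta> \<subseteq> snd c ` fst c"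
  obtains C where "compact C" "C \<subseteq> fst c" "snd c ` C = cball (snd c p) \<delta>" "p \<in> interior C"
proof -
  note ch = C1_manifold_chart[OF A charts_atD(1)[OF c]]
  obtain B :: "'b set" where "finite_basis B"
    using C1_manifold_finite_basis[OF A] by blast
  then interpret finite_basis B .
  define C where "C = {q \<in> fst c. snd c q \<in> cball (snd c p) \<delta>}"
  have img: "snd c ` C = cball (snd c p) \<delta>"
    using \<delta>(2) unfolding C_def by blast
  have "C = chart_inv c ` cball (snd c p) \<delta>"
    unfolding img[symmetric] image_image using chart_inv_chart[OF ch] by (auto simp: C_def image_iff)
  moreover have "continuous_on (cball (snd c p) \<delta>) (chart_inv c)"
    using continuous_on_chart_inv[OF ch] \<delta>(2) by (rule continuous_on_subset)
  ultimately have "compact C"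
    using compact_continuous_image compact_cball by metis
  moreover have "p \<in> interior C"
  proof (rule interiorI)
    show "open (fst c \<inter> snd c -` ball (snd c p) \<delta>)"
      using ch continuous_on_chart[OF ch] by (intro continuous_open_preimage) (auto simp: is_chart_def)
  qed (use \<delta>(1) charts_atD(2)[OF c] in \<open>auto simp: C_def\<close>)
  moreover have "C \<subseteq> fst c" by (auto simp: C_def)
  ultimately show ?thesis using that img by blast
qed

text \<open>
  The open set \<open>U\<close> bounds the domain of the source chart; small domains are needed for locally finite
  families of constraints.
\<close>

lemma stable_transversality_constraint:
  fixes L :: "('m::{t2_space, second_countable_topology}, 'd::real_normed_vector) chart set"
    and N :: "('n::{t2_space, second_countable_topology}, 'e::real_normed_vector) chart set"
    and P :: "('p::{t2_space, second_countable_topology}, 'f::real_normed_vector) chart set"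
  assumes L: "C1_manifold L" and N: "C1_manifold N" and V: "closed V" and \<Sigma>: "prestratification N V \<Sigma>"
    and f: "f \<in> C1_maps N P" and af: "af_regular N P f \<Sigma>"
    and g: "g \<in> C1_maps L N" and U: "open U" "w \<in> U" and tr: "transverse_on L N P f \<Sigma> {w} g"
  shows "\<exists>c d C \<epsilon>. admissible L N g (c, d, C, \<epsilon>) \<and> fst c \<subseteq> U \<and> w \<in> interior C \<and>
    (\<forall>h\<in>C1_nbhd L N g (c, d, C, \<epsilon>). transverse_on L N P f \<Sigma> C h)"
proof -
  have leaf: "leaf_tangent N P f S y \<subseteq> tangent_space N y" for S y
    by (auto simp: leaf_tangent_def sub_tangent_space_def)
  obtain d where d: "d \<in> charts_at N (g w)"
    using charts_at_nonempty[OF N] by blast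
  obtain c0 where c0: "c0 \<in> charts_at L w"
    using charts_at_nonempty[OF L] by blast
  define c where "c = (fst c0 \<inter> U, snd c0)"
  have cU: "fst c \<subseteq> U" by (simp add: c_def)
  have c: "c \<in> charts_at L w"
    using restrict_chart[OF L charts_atD(1)[OF c0] U(1)] charts_atD(2)[OF c0] U(2)
    by (simp add: charts_at_def c_def)
  note cL = charts_atD(1)[OF c] and dN = charts_atD(1)[OF d]
  note chc = C1_manifold_chart[OF L cL] and chd = C1_manifold_chart[OF N dN]
  let ?T = "local_deriv c d g w"
  let ?a = "snd c w"
  have "chart_transverse ?T (coord d (leaf_tangent N P f Y (g w)))" if "Y \<in> \<Sigma>" "g w \<in> Y" for Y
    using tr that transverse_in_charts[OF L N g c d leaf] by (simp add: transverse_on_def)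
  then obtain W \<epsilon>1 where W: "open W" "g w \<in> W" "W \<subseteq> fst d" and \<epsilon>1: "\<epsilon>1 > 0"
    and stable: "\<And>x T X. x \<in> W \<Longrightarrow> linear T \<Longrightarrow> (\<forall>v. norm (T v - ?T v) \<le> \<epsilon>1 * norm v) \<Longrightarrow>
      X \<in> \<Sigma> \<Longrightarrow> x \<in> X \<Longrightarrow> chart_transverse T (coord d (leaf_tangent N P f X x))"
    using transversality_semicontinuous[OF N V \<Sigma> f af d, of ?T] by metis
  have "open (snd d ` W)"
    using open_chart_image[OF chd W(1)] W(3) by (simp add: Int_absorb1)
  then obtain \<rho>' where \<rho>': "\<rho>' > 0" "ball (snd d (g w)) \<rho>' \<subseteq> snd d ` W"
    using W(2) by (meson imageI openE)
  \<comment> \<open>half of the radius for the variation of \<open>g\<close> on the ball, half for the distance from \<open>h\<close> to \<open>g\<close>; likewise for \<open>\<epsilon>1\<close>\<close>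
  define \<rho> where "\<rho> = \<rho>' / 2"
  have \<rho>: "\<rho> > 0" using \<rho>'(1) by (simp add: \<rho>_def)
  let ?D = "snd c ` (fst c \<inter> g -` fst d)"
  have D: "open ?D" "?a \<in> ?D"
    using open_local_domain[OF L N g cL dN] charts_atD(2)[OF c] charts_atD(2)[OF d] by auto
  have C1: "C1_on ?D (local_rep c d g)"
    using g cL dN by (auto simp: C1_maps_def)
  have "\<epsilon>1 / 2 > 0" using \<epsilon>1 by simp
  from C1_on_derivative_close[OF C1 D this]
  obtain \<delta>1 where \<delta>1: "\<delta>1 > 0" "\<And>x. dist x ?a < \<delta>1 \<Longrightarrow> x \<in> ?D"
    "\<And>x v. dist x ?a < \<delta>1 \<Longrightarrow> norm (frechet_derivative (local_rep c d g) (at x) v - ?T v) \<le> \<epsilon>1 / 2 * norm v"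
    unfolding local_deriv_def by metis
  have "isCont (local_rep c d g) ?a"
    using has_derivative_continuous[OF local_rep_has_derivative[OF g c d]] .
  then obtain \<delta>2 where \<delta>2: "\<delta>2 > 0"
    "\<And>x. dist x ?a < \<delta>2 \<Longrightarrow> dist (local_rep c d g x) (local_rep c d g ?a) < \<rho>"
    using \<rho> unfolding continuous_at_eps_delta by metis
  define \<delta> where "\<delta> = min \<delta>1 \<delta>2 / 2"
  have \<delta>: "\<delta> > 0" and \<delta>_less: "\<And>x. x \<in> cball ?a \<delta> \<Longrightarrow> dist x ?a < \<delta>1 \<and> dist x ?a < \<delta>2"
    using \<delta>1(1) \<delta>2(1) by (auto simp: \<delta>_def dist_commute min_def split: if_splits)
  have ball: "cball ?a \<delta> \<subseteq> ?D"
    using \<delta>_less \<delta>1(2) by blast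
  then have "cball ?a \<delta> \<subseteq> snd c ` fst c" by blast
  from compact_coordinate_ball[OF L c \<delta> this]
  obtain C where C: "compact C" "C \<subseteq> fst c" "snd c ` C = cball ?a \<delta>" "w \<in> interior C"
    by blast
  define \<epsilon> where "\<epsilon> = min \<rho> (\<epsilon>1 / 2)"
  have "g q \<in> fst d" if q: "q \<in> C" for q
  proof -
    have "snd c q \<in> ?D" using q C(3) ball by blast
    then obtain q' where "q' \<in> fst c" "g q' \<in> fst d" "snd c q = snd c q'" by auto
    moreover have "q \<in> fst c" using q C(2) by blast
    ultimately show ?thesis
      using is_chart_inj_on[OF chc] by (metis inj_onD)
  qed
  then have adm: "admissible L N g (c, d, C, \<epsilon>)"
    using cL dN C(1,2) \<rho> \<epsilon>1 by (auto simp: admissible_def \<epsilon>_def)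
  moreover have "transverse_on L N P f \<Sigma> C h" if h: "h \<in> C1_nbhd L N g (c, d, C, \<epsilon>)" for h
    unfolding transverse_on_def
  proof (intro ballI impI)
    fix p S assume p: "p \<in> C" and S: "S \<in> \<Sigma>" "h p \<in> S"
    have hC: "h \<in> C1_maps L N" and "h ` C \<subseteq> fst d"
      and h_close: "\<And>x. x \<in> snd c ` C \<Longrightarrow> norm (local_rep c d h x - local_rep c d g x) < \<epsilon>"
      and h_deriv: "\<And>x. x \<in> snd c ` C \<Longrightarrow> onorm (\<lambda>v. frechet_derivative (local_rep c d h) (at x) v
          - frechet_derivative (local_rep c d g) (at x) v) < \<epsilon>"
      using h by (auto simp: C1_nbhd_def)
    have cp: "c \<in> charts_at L p" and dp: "d \<in> charts_at N (h p)" and dg: "d \<in> charts_at N (g p)"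
      using p C(2) cL dN \<open>h ` C \<subseteq> fst d\<close> \<open>\<And>q. q \<in> C \<Longrightarrow> g q \<in> fst d\<close> by (auto simp: charts_at_def)
    let ?x = "snd c p"
    have x: "?x \<in> snd c ` C" "dist ?x ?a < \<delta>1" "dist ?x ?a < \<delta>2"
    proof -
      show "?x \<in> snd c ` C" using p by blast
      then show "dist ?x ?a < \<delta>1" "dist ?x ?a < \<delta>2"
        unfolding C(3) using \<delta>_less by blast+
    qed
    have "dist (snd d (h p)) (local_rep c d g ?x) < \<rho>"
      using h_close[OF x(1)] local_rep_at[OF chc charts_atD(2)[OF cp], of d h]
      by (simp add: dist_norm \<epsilon>_def)
    moreover have "dist (local_rep c d g ?x) (snd d (g w)) < \<rho>"
      using \<delta>2(2)[OF x(3)] local_rep_at[OF chc charts_atD(2)[OF c], of d g] by simp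
    ultimately have "dist (snd d (h p)) (snd d (g w)) < \<rho>'"
      using dist_triangle[of "snd d (h p)" "snd d (g w)" "local_rep c d g ?x"] by (simp add: \<rho>_def)
    then have "snd d (h p) \<in> snd d ` W"
      using \<rho>'(2) by (auto simp: dist_commute)
    then have hW: "h p \<in> W"
      using W(3) charts_atD(2)[OF dp] is_chart_inj_on[OF chd] by (auto dest: inj_onD)
    let ?H = "local_deriv c d h p" and ?G = "local_deriv c d g p"
    have "bounded_linear (\<lambda>v. ?H v - ?G v)"
      using has_derivative_bounded_linear[OF local_rep_has_derivative[OF hC cp dp]]
        has_derivative_bounded_linear[OF local_rep_has_derivative[OF g cp dg]]
      by (rule bounded_linear_sub)
    moreover have "onorm (\<lambda>v. ?H v - ?G v) \<le> \<epsilon>1 / 2"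
      using h_deriv[OF x(1)] by (simp add: local_deriv_def \<epsilon>_def)
    ultimately have HG: "norm (?H v - ?G v) \<le> \<epsilon>1 / 2 * norm v" for v
      by (meson onorm mult_right_mono norm_ge_zero order_trans)
    have GT: "norm (?G v - ?T v) \<le> \<epsilon>1 / 2 * norm v" for v
      using \<delta>1(3)[OF x(2)] by (simp add: local_deriv_def[of c d g p])
    have "norm (?H v - ?T v) \<le> \<epsilon>1 * norm v" for v
    proof -
      have "norm (?H v - ?T v) \<le> norm (?H v - ?G v) + norm (?G v - ?T v)"
        using norm_triangle_ineq[of "?H v - ?G v" "?G v - ?T v"] by simp
      also have "\<dots> \<le> \<epsilon>1 / 2 * norm v + \<epsilon>1 / 2 * norm v"
        by (intro add_mono HG GT)
      finally show ?thesis by simp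
    qed
    then have "\<forall>v. norm (?H v - ?T v) \<le> \<epsilon>1 * norm v" by blast
    then have "chart_transverse ?H (coord d (leaf_tangent N P f S (h p)))"
      by (rule stable[OF hW linear_local_deriv[OF hC cp dp] _ S])
    then show "tvec_sum (differential L N h p ` tangent_space L p) (leaf_tangent N P f S (h p))
        = tangent_space N (h p)"
      using transverse_in_charts[OF L N hC cp dp leaf] by blast
  qed
  ultimately show ?thesis
    using cU C(4) by blast
qed

lemma C1_nbhd_self: "g \<in> C1_maps M N \<Longrightarrow> admissible M N g \<theta> \<Longrightarrow> g \<in> C1_nbhd M N g \<theta>"
  by (cases \<theta>) (auto simp: C1_nbhd_def admissible_def onorm_zero)

text \<open>
  A manifold is locally compact, so by second countability it is covered by the interiors of
  countably many compact sets \<open>Q n\<close>; enlarge \<open>E n \<union> Q n\<close> to a compact neighbourhood to get \<open>E (Suc n)\<close>.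
\<close>

lemma compact_exhaustion:
  fixes A :: "('m::{t2_space, second_countable_topology}, 'e::real_normed_vector) chart set"
  assumes A: "C1_manifold A"
  obtains E :: "nat \<Rightarrow> 'm set" where "E 0 = {}" "\<And>n. compact (E n)" "\<And>n. E n \<subseteq> interior (E (Suc n))"
    "(\<Union>n. E n) = UNIV"
proof -
  have nbhd: "\<exists>C. compact C \<and> p \<in> interior C" for p :: 'm
  proof -
    obtain c where c: "c \<in> charts_at A p"
      using charts_at_nonempty[OF A] by blast
    have "open (snd c ` fst c)"
      using C1_manifold_chart[OF A charts_atD(1)[OF c]] by (simp add: is_chart_def)
    then obtain \<delta> where "\<delta> > 0" "cball (snd c p) \<delta> \<subseteq> snd c ` fst c"
      using charts_atD(2)[OF c] by (meson imageI open_contains_cball)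
    then show ?thesis
      by (rule compact_coordinate_ball[OF A c]) auto
  qed
  have absorb: "\<exists>Y. compact Y \<and> X \<subseteq> interior Y" if X: "compact X" for X :: "'m set"
  proof -
    obtain C where C: "\<And>p :: 'm. compact (C p)" "\<And>p :: 'm. p \<in> interior (C p)"
      using nbhd by metis
    have "X \<subseteq> (\<Union>p\<in>X. interior (C p))" using C(2) by blast
    from compactE_image[OF X _ this] obtain I where I: "I \<subseteq> X" "finite I" "X \<subseteq> (\<Union>p\<in>I. interior (C p))"
      by (metis open_interior)
    have cpt: "compact (\<Union>p\<in>I. C p)" using I(2) C(1) by (intro compact_UN) auto
    have "(\<Union>p\<in>I. interior (C p)) \<subseteq> interior (\<Union>p\<in>I. C p)"
      by (intro UN_least interior_mono) auto
    with I(3) have "X \<subseteq> interior (\<Union>p\<in>I. C p)" by (rule order_trans)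
    with cpt show ?thesis by (intro exI conjI)
  qed
  have "\<exists>F. \<forall>X :: 'm set. compact X \<longrightarrow> compact (F X) \<and> X \<subseteq> interior (F X)"
    using absorb by (intro choice) blast
  then obtain F where F: "\<And>X :: 'm set. compact X \<Longrightarrow> compact (F X)"
    "\<And>X :: 'm set. compact X \<Longrightarrow> X \<subseteq> interior (F X)"
    by auto
  obtain \<B> :: "'m set set" where \<B>: "\<B> \<subseteq> {interior C | C. compact C}" "countable \<B>"
    "\<Union>\<B> = \<Union>{interior C | C. compact (C :: 'm set)}"
    using Lindelof[of "{interior C | C. compact (C :: 'm set)}"] by blast
  have cover: "\<Union>\<B> = UNIV" unfolding \<B>(3) using nbhd by blast
  then have ne: "\<B> \<noteq> {}" by auto
  have "\<exists>Q. compact Q \<and> from_nat_into \<B> n = interior Q" for n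
    using from_nat_into[OF ne, of n] \<B>(1) by blast
  then obtain Q where Q: "\<And>n. compact (Q n)" "\<And>n. from_nat_into \<B> n = interior (Q n)"
    by metis
  define E where "E = rec_nat {} (\<lambda>n X. F (X \<union> Q n))"
  have E: "E 0 = {}" "E (Suc n) = F (E n \<union> Q n)" for n by (simp_all add: E_def)
  have cpt: "compact (E n)" for n
    by (induction n) (simp_all add: E Q(1) F(1) compact_Un)
  have sub: "E n \<union> Q n \<subseteq> interior (E (Suc n))" for n
    unfolding E(2) by (intro F(2) compact_Un cpt Q(1))
  have Q_sub: "interior (Q n) \<subseteq> E (Suc n)" for n
    using sub[of n] interior_subset[of "Q n"] interior_subset[of "E (Suc n)"] by auto
  show ?thesis
  proof (rule that[of E])
    show "(\<Union>n. E n) = UNIV"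
    proof (intro UNIV_eq_I[symmetric])
      fix p
      have "p \<in> \<Union>\<B>" by (simp add: cover)
      then obtain S where "S \<in> \<B>" "p \<in> S" by (rule UnionE)
      then obtain n where "p \<in> from_nat_into \<B> n"
        using from_nat_into_surj[OF \<B>(2)] by metis
      then have "p \<in> E (Suc n)"
        using Q(2)[of n] Q_sub[of n] by auto
      then show "p \<in> (\<Union>n. E n)" by blast
    qed
  qed (use cpt sub E(1) in auto)
qed

section \<open>Openness in the weak and in the strong topology\<close>

lemma openin_weak_C1_nbhd:
  "g \<in> C1_maps M N \<Longrightarrow> admissible M N g \<theta> \<Longrightarrow> openin (weak_C1_topology M N) (C1_nbhd M N g \<theta>)"
  unfolding weak_C1_topology_def by (rule topology_generated_by_Basis) blast

lemma openin_strong_C1_nbhds: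
  assumes "g \<in> C1_maps M N" "\<And>\<theta>. \<theta> \<in> \<Theta> \<Longrightarrow> admissible M N g \<theta>" "locally_finite_constraints \<Theta>"
  shows "openin (strong_C1_topology M N) (C1_maps M N \<inter> (\<Inter>\<theta>\<in>\<Theta>. C1_nbhd M N g \<theta>))"
  unfolding strong_C1_topology_def by (rule topology_generated_by_Basis) (use assms in blast)

lemma C1_nbhd_subset: "C1_nbhd M N g \<theta> \<subseteq> C1_maps M N"
  by (cases \<theta>) (auto simp: C1_nbhd_def)

locale af_regular_stratification =
  fixes N :: "('n::{t2_space, second_countable_topology}, 'e::real_normed_vector) chart set"
    and P :: "('p::{t2_space, second_countable_topology}, 'f::real_normed_vector) chart set"
    and V :: "'n set" and \<Sigma> :: "'n set set" and f :: "'n \<Rightarrow> 'p"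
  assumes N: "C1_manifold N" and V: "closed V" and \<Sigma>: "prestratification N V \<Sigma>"
    and f: "f \<in> C1_maps N P" and af: "af_regular N P f \<Sigma>"
begin

lemma finite_stable_constraints:
  fixes M :: "('m::{t2_space, second_countable_topology}, 'd::real_normed_vector) chart set"
  assumes M: "C1_manifold M" and g: "g \<in> C1_maps M N" and K: "compact K"
    and U: "open U" "K \<subseteq> U" and tr: "transverse_on M N P f \<Sigma> K g"
  shows "\<exists>\<Theta>. finite \<Theta> \<and> (\<forall>\<theta>\<in>\<Theta>. admissible M N g \<theta> \<and> fst (fst \<theta>) \<subseteq> U) \<and>
    (\<forall>h. (\<forall>\<theta>\<in>\<Theta>. h \<in> C1_nbhd M N g \<theta>) \<longrightarrow> transverse_on M N P f \<Sigma> K h)"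
proof -
  define good where "good w \<theta> \<longleftrightarrow> admissible M N g \<theta> \<and> fst (fst \<theta>) \<subseteq> U \<and> w \<in> interior (fst (snd (snd \<theta>))) \<and>
    (\<forall>h\<in>C1_nbhd M N g \<theta>. transverse_on M N P f \<Sigma> (fst (snd (snd \<theta>))) h)" for w \<theta>
  have "\<exists>\<theta>. good w \<theta>" if w: "w \<in> K" for w
  proof -
    have "w \<in> U" "transverse_on M N P f \<Sigma> {w} g"
      using w U(2) tr by (auto simp: transverse_on_def)
    then obtain c d C \<epsilon> where "admissible M N g (c, d, C, \<epsilon>) \<and> fst c \<subseteq> U \<and> w \<in> interior C \<and>
        (\<forall>h\<in>C1_nbhd M N g (c, d, C, \<epsilon>). transverse_on M N P f \<Sigma> C h)"
      using stable_transversality_constraint[OF M N V \<Sigma> f af g U(1)] by blast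
    then have "good w (c, d, C, \<epsilon>)"
      by (simp add: good_def)
    then show ?thesis ..
  qed
  then obtain \<theta> where \<theta>: "\<And>w. w \<in> K \<Longrightarrow> good w (\<theta> w)"
    by metis
  have "\<And>w. w \<in> K \<Longrightarrow> open (interior (fst (snd (snd (\<theta> w)))))" by simp
  moreover have "K \<subseteq> (\<Union>w\<in>K. interior (fst (snd (snd (\<theta> w)))))"
    using \<theta> unfolding good_def by blast
  ultimately obtain I where I: "I \<subseteq> K" "finite I" "K \<subseteq> (\<Union>w\<in>I. interior (fst (snd (snd (\<theta> w)))))"
    by (rule compactE_image[OF K])
  have "transverse_on M N P f \<Sigma> K h" if h: "\<forall>t\<in>\<theta> ` I. h \<in> C1_nbhd M N g t" for h
  proof -
    have "transverse_on M N P f \<Sigma> (fst (snd (snd (\<theta> w)))) h" if "w \<in> I" for w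
      using \<theta>[of w] h that I(1) unfolding good_def by blast
    moreover have "\<exists>w\<in>I. p \<in> fst (snd (snd (\<theta> w)))" if "p \<in> K" for p
      using that I(3) interior_subset by blast
    ultimately show ?thesis
      unfolding transverse_on_def by blast
  qed
  moreover have "admissible M N g t \<and> fst (fst t) \<subseteq> U" if "t \<in> \<theta> ` I" for t
    using that \<theta> I(1) unfolding good_def by blast
  ultimately show ?thesis
    using I(2) by (intro exI[of _ "\<theta> ` I"]) simp
qed

text \<open>
  Every \<open>g\<close> in the set has the finite intersection of its stable constraints as a neighbourhood.
\<close>

lemma openin_weak_transverse:
  fixes M :: "('m::{t2_space, second_countable_topology}, 'd::real_normed_vector) chart set"
  assumes M: "C1_manifold M" and K: "compact K"
  shows "openin (weak_C1_topology M N) {g \<in> C1_maps M N. transverse_on M N P f \<Sigma> K g}"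
proof (subst openin_subopen, intro ballI)
  fix g assume "g \<in> {g \<in> C1_maps M N. transverse_on M N P f \<Sigma> K g}"
  then have g: "g \<in> C1_maps M N" and tr: "transverse_on M N P f \<Sigma> K g" by auto
  obtain \<Theta> where \<Theta>: "finite \<Theta>" "\<And>\<theta>. \<theta> \<in> \<Theta> \<Longrightarrow> admissible M N g \<theta>"
    "\<And>h. (\<forall>\<theta>\<in>\<Theta>. h \<in> C1_nbhd M N g \<theta>) \<Longrightarrow> transverse_on M N P f \<Sigma> K h"
    using finite_stable_constraints[OF M g K open_UNIV _ tr] by auto
  obtain c where c: "c \<in> charts_at M undefined"
    using charts_at_nonempty[OF M] by blast
  obtain d where d: "d \<in> charts_at N undefined"
    using charts_at_nonempty[OF N] by blast
  \<comment> \<open>a vacuous constraint keeps the intersection nonempty and inside the space of \<open>C\<^sup>1\<close>-maps if \<open>K = {}\<close>\<close>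
  let ?\<theta>\<^sub>0 = "(c, d, {}, 1) :: ('m, 'd, 'n, 'e) constraint"
  let ?U = "\<Inter>\<theta>\<in>insert ?\<theta>\<^sub>0 \<Theta>. C1_nbhd M N g \<theta>"
  have adm: "admissible M N g \<theta>" if "\<theta> \<in> insert ?\<theta>\<^sub>0 \<Theta>" for \<theta>
  proof (cases "\<theta> = ?\<theta>\<^sub>0")
    case True
    then show ?thesis
      using charts_atD(1)[OF c] charts_atD(1)[OF d] by (simp add: admissible_def)
  qed (use that \<Theta>(2) in blast)
  have "openin (weak_C1_topology M N) ?U"
    using \<Theta>(1) adm openin_weak_C1_nbhd[OF g] by (intro openin_INT2) auto
  moreover have "g \<in> ?U"
    using C1_nbhd_self[OF g adm] by blast
  moreover have "?U \<subseteq> {g \<in> C1_maps M N. transverse_on M N P f \<Sigma> K g}"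
    using C1_nbhd_subset[of M N g ?\<theta>\<^sub>0] \<Theta>(3) by auto
  ultimately show "\<exists>T. openin (weak_C1_topology M N) T \<and> g \<in> T \<and>
      T \<subseteq> {g \<in> C1_maps M N. transverse_on M N P f \<Sigma> K g}"
    by (intro exI conjI)
qed

text \<open>
  Only the layers \<open>A n\<close> of \<open>K\<close> are compact, so each gets finitely many constraints of its own, with
  charts inside the open shell \<open>U n\<close> around the layer. A compact set \<open>E m\<close> meets only finitely many
  shells, which makes the union of all these constraints locally finite.
\<close>

lemma openin_strong_transverse:
  fixes M :: "('m::{t2_space, second_countable_topology}, 'd::real_normed_vector) chart set"
  assumes M: "C1_manifold M" and K: "closed K"
  shows "openin (strong_C1_topology M N) {g \<in> C1_maps M N. transverse_on M N P f \<Sigma> K g}"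
proof (subst openin_subopen, intro ballI)
  fix g assume "g \<in> {g \<in> C1_maps M N. transverse_on M N P f \<Sigma> K g}"
  then have g: "g \<in> C1_maps M N" and tr: "transverse_on M N P f \<Sigma> K g" by auto
  obtain E :: "nat \<Rightarrow> 'm set" where E: "E 0 = {}" "\<And>n. compact (E n)" "\<And>n. E n \<subseteq> interior (E (Suc n))"
    "(\<Union>n. E n) = UNIV"
    by (rule compact_exhaustion[OF M]) blast
  have E_mono: "E i \<subseteq> E j" if "i \<le> j" for i j
    using order_trans[OF E(3) interior_subset] that by (rule lift_Suc_mono_le)
  define A where "A n = K \<inter> (E (Suc n) - interior (E n))" for n
  \<comment> \<open>for \<open>n = 0\<close> the truncated difference gives \<open>E 0 = {}\<close>, so nothing is removed\<close>
  define U where "U n = interior (E (Suc (Suc n))) - E (n - 1)" for n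
  have A_compact: "compact (A n)" for n
    unfolding A_def using K E(2) by (intro closed_Int_compact compact_diff) auto
  have U_open: "open (U n)" for n
    unfolding U_def using E(2) by (intro open_Diff compact_imp_closed) auto
  have AU: "A n \<subseteq> U n" for n
  proof -
    have "E (n - 1) \<subseteq> interior (E n)"
      using E(1,3) by (cases n) auto
    then show ?thesis
      using E(3)[of "Suc n"] by (auto simp: A_def U_def)
  qed
  have "transverse_on M N P f \<Sigma> (A n) g" for n
    using tr by (auto simp: A_def transverse_on_def)
  note ex = finite_stable_constraints[OF M g A_compact U_open AU this]
  define good where "good n \<Theta> \<longleftrightarrow> finite \<Theta> \<and> (\<forall>\<theta>\<in>\<Theta>. admissible M N g \<theta> \<and> fst (fst \<theta>) \<subseteq> U n) \<and>
    (\<forall>h. (\<forall>\<theta>\<in>\<Theta>. h \<in> C1_nbhd M N g \<theta>) \<longrightarrow> transverse_on M N P f \<Sigma> (A n) h)" for n \<Theta>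
  have "\<forall>n. \<exists>\<Theta>. good n \<Theta>"
    unfolding good_def using ex by (rule allI)
  then obtain \<Theta> where \<Theta>: "\<And>n. good n (\<Theta> n)"
    by metis
  let ?\<Theta> = "\<Union>n. \<Theta> n"
  have adm: "admissible M N g \<theta>" if "\<theta> \<in> ?\<Theta>" for \<theta>
    using that \<Theta> unfolding good_def by blast
  have "locally_finite_constraints ?\<Theta>"
    unfolding locally_finite_constraints_def
  proof
    fix p
    obtain m where m: "p \<in> E m" using E(4) by blast
    let ?W = "interior (E (Suc m))"
    have "{\<theta>\<in>?\<Theta>. fst (fst \<theta>) \<inter> ?W \<noteq> {}} \<subseteq> (\<Union>n\<le>Suc m. \<Theta> n)"
    proof
      fix \<theta> assume "\<theta> \<in> {\<theta>\<in>?\<Theta>. fst (fst \<theta>) \<inter> ?W \<noteq> {}}"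
      then obtain n where n: "\<theta> \<in> \<Theta> n" "fst (fst \<theta>) \<inter> ?W \<noteq> {}" by blast
      then have "U n \<inter> ?W \<noteq> {}"
        using \<Theta>[of n] unfolding good_def by blast
      then have "\<not> E (Suc m) \<subseteq> E (n - 1)"
        using interior_subset[of "E (Suc m)"] by (auto simp: U_def)
      then have "n \<le> Suc m"
        using E_mono[of "Suc m" "n - 1"] by linarith
      then show "\<theta> \<in> (\<Union>n\<le>Suc m. \<Theta> n)" using n(1) by blast
    qed
    moreover have "finite (\<Union>n\<le>Suc m. \<Theta> n)"
      using \<Theta> unfolding good_def by blast
    ultimately have "finite {\<theta>\<in>?\<Theta>. fst (fst \<theta>) \<inter> ?W \<noteq> {}}"
      by (rule finite_subset)
    then show "\<exists>W. open W \<and> p \<in> W \<and> finite {\<theta>\<in>?\<Theta>. fst (fst \<theta>) \<inter> W \<noteq> {}}"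
      using m E(3)[of m] by (intro exI[of _ ?W]) auto
  qed
  then have "openin (strong_C1_topology M N) (C1_maps M N \<inter> (\<Inter>\<theta>\<in>?\<Theta>. C1_nbhd M N g \<theta>))"
    by (intro openin_strong_C1_nbhds g adm)
  moreover have "g \<in> C1_maps M N \<inter> (\<Inter>\<theta>\<in>?\<Theta>. C1_nbhd M N g \<theta>)"
    using C1_nbhd_self[OF g adm] g by blast
  moreover have "C1_maps M N \<inter> (\<Inter>\<theta>\<in>?\<Theta>. C1_nbhd M N g \<theta>)
      \<subseteq> {g \<in> C1_maps M N. transverse_on M N P f \<Sigma> K g}"
  proof
    fix h assume h: "h \<in> C1_maps M N \<inter> (\<Inter>\<theta>\<in>?\<Theta>. C1_nbhd M N g \<theta>)"
    have hA: "transverse_on M N P f \<Sigma> (A n) h" for n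
    proof -
      have "\<forall>\<theta>\<in>\<Theta> n. h \<in> C1_nbhd M N g \<theta>" using h by auto
      then show ?thesis using \<Theta>[of n] by (simp add: good_def)
    qed
    have "\<exists>n. w \<in> A n" if w: "w \<in> K" for w
    proof -
      have ex: "\<exists>m. w \<in> E m" using E(4) by blast
      define m where "m = (LEAST m. w \<in> E m)"
      have m: "w \<in> E m" unfolding m_def using ex by (rule LeastI_ex)
      then obtain n where n: "m = Suc n" using E(1) by (cases m) auto
      have "w \<notin> E n" using not_less_Least[of n "\<lambda>m. w \<in> E m"] n by (simp add: m_def[symmetric])
      then show ?thesis
        using m n w interior_subset[of "E n"] by (auto simp: A_def)
    qed
    then have "transverse_on M N P f \<Sigma> K h"
      using hA unfolding transverse_on_def by blast
    then show "h \<in> {g \<in> C1_maps M N. transverse_on M N P f \<Sigma> K g}" using h by blast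
  qed
  ultimately show "\<exists>T. openin (strong_C1_topology M N) T \<and> g \<in> T \<and>
      T \<subseteq> {g \<in> C1_maps M N. transverse_on M N P f \<Sigma> K g}"
    by (intro exI conjI)
qed

end

theorem theorem3p1:
  fixes N :: "('n::{t2_space, second_countable_topology}, 'e::real_normed_vector) chart set"
    and P :: "('p::{t2_space, second_countable_topology}, 'f::real_normed_vector) chart set"
    and V :: "'n set" and \<Sigma> :: "'n set set" and f :: "'n \<Rightarrow> 'p"
  assumes "C1_manifold N" and "C1_manifold P"
    and "closed V" and "prestratification N V \<Sigma>"
    and "stratified_map N P \<Sigma> f"
    and "af_regular N P f \<Sigma>"
  shows "(\<forall>(M :: ('m::{t2_space, second_countable_topology}, 'd::real_normed_vector) chart set) K.
            C1_manifold M \<longrightarrow> compact K \<longrightarrow>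
            openin (weak_C1_topology M N) {g \<in> C1_maps M N. transverse_on M N P f \<Sigma> K g})
       \<and> (\<forall>(M :: ('m, 'd) chart set) K.
            C1_manifold M \<longrightarrow> closed K \<longrightarrow>
            openin (strong_C1_topology M N) {g \<in> C1_maps M N. transverse_on M N P f \<Sigma> K g})"
proof -
  interpret af_regular_stratification N P V \<Sigma> f
    using assms by unfold_locales (auto simp: stratified_map_def)
  show ?thesis
    using openin_weak_transverse openin_strong_transverse by blast
qed

end
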